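(* The category $\mathsf{KRFrm}$ of compact regular frames and frame homomorphisms is dually equivalent to the category $\mathsf{KRLPries}$ of KRL-spaces and L-morphisms.
   Context: A frame is a complete lattice $L$ satisfying $a\wedge\bigvee S=\bigvee\{a\wedge s\mid s\in S\}$ for all $a\in L$, $S\subseteq L$. A frame homomorphism is a map between frames preserving finite meets and arbitrary joins. $L$ is compact if whenever $1=\bigvee S$ there is a finite $T\subseteq S$ with $1=\bigvee T$. The pseudocomplement of $a$ is $a^*=\bigvee\{x\in L\mid a\wedge x=0\}$, and $a\prec b$ (well inside) means $a^*\vee b=1$. $L$ is regular if $a=\bigvee\{b\in L\mid b\prec a\}$ for all $a\in L$. $\mathsf{KRFrm}$ is the category of compact regular frames and all frame homomorphisms. For a poset, $\mathord\uparrow S$ and $\mathord\downarrow S$ denote the up-closure and down-closure of a subset $S$; $\mathord\downarrow x=\mathord\downarrow\{x\}$; $S$ is an upset if $S=\mathord\uparrow S$; $\min(S)$ is the set of minimal elements of $S$. $\mathrm{cl}$ is topological closure. A Priestley space is a compact topological space $X$ with a partial order $\le$ such that whenever $x\not\le y$ there is a clopen upset $U$ with $x\in U$, $y\notin U$. $\mathrm{ClopUp}(X)$ is the set of clopen upsets of $X$. An Esakia space is a Priestley space in which $\mathord\downarrow U$ is clopen for every clopen $U$. An L-space is an Esakia space in which $\mathrm{cl}\,U$ is open for every open upset $U$. An L-morphism $f:X_1\to X_2$ between L-spaces is a continuous order-preserving map such that $f^{-1}(\mathrm{cl}\,U)=\mathrm{cl}\,f^{-1}(U)$ for every open upset $U$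 of $X_2$. Let $X$ be an L-space. The localic part of $X$ is $Y=\{y\in X\mid\mathord\downarrow y\text{ is clopen}\}$. A Scott upset of $X$ is a closed upset $F$ with $\min(F)\subseteq Y$. $X$ is L-compact if $X$ itself is a Scott upset (i.e. $\min(X)\subseteq Y$). For $U,V\in\mathrm{ClopUp}(X)$, $V\prec U$ means $\mathord\downarrow V\subseteq U$, and the regular part of $U$ is $\mathrm{reg}\,U=\bigcup\{V\in\mathrm{ClopUp}(X)\mid V\prec U\}$. $X$ is L-regular if $\mathrm{reg}\,U$ is dense in $U$ for every $U\in\mathrm{ClopUp}(X)$. A KRL-space is an L-space that is L-compact and L-regular. $\mathsf{KRLPries}$ is the category of KRL-spaces and all L-morphisms between them. *)

theory Defs
  imports "HOL-Algebra.Complete_Lattice" "HOL-Analysis.Abstract_Topology"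
begin

section \<open>Categories and contravariant functors\<close>

text \<open>
  Hom-sets are indexed by domain and codomain and need not be disjoint; accordingly
  composition and the action of a functor on morphisms take the objects involved as
  arguments: if \<open>f \<in> Hom C a b\<close> and \<open>g \<in> Hom C b c\<close>, then \<open>Comp C a b c g f \<in> Hom C a c\<close>.
\<close>

record ('o, 'm) category =
  Obj :: "'o set"
  Hom :: "'o \<Rightarrow> 'o \<Rightarrow> 'm set"
  Comp :: "'o \<Rightarrow> 'o \<Rightarrow> 'o \<Rightarrow> 'm \<Rightarrow> 'm \<Rightarrow> 'm"
  Id :: "'o \<Rightarrow> 'm"

definition is_category :: "('o, 'm) category \<Rightarrow> bool" where
  "is_category C \<longleftrightarrow>
     (\<forall>a\<in>Obj C. Id C a \<in> Hom C a a) \<and>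
     (\<forall>a\<in>Obj C. \<forall>b\<in>Obj C. \<forall>c\<in>Obj C. \<forall>f\<in>Hom C a b. \<forall>g\<in>Hom C b c.
        Comp C a b c g f \<in> Hom C a c) \<and>
     (\<forall>a\<in>Obj C. \<forall>b\<in>Obj C. \<forall>f\<in>Hom C a b.
        Comp C a a b f (Id C a) = f \<and> Comp C a b b (Id C b) f = f) \<and>
     (\<forall>a\<in>Obj C. \<forall>b\<in>Obj C. \<forall>c\<in>Obj C. \<forall>d\<in>Obj C.
      \<forall>f\<in>Hom C a b. \<forall>g\<in>Hom C b c. \<forall>h\<in>Hom C c d.
        Comp C a c d h (Comp C a b c g f) = Comp C a b d (Comp C b c d h g) f)"

definition contravariant_functor ::
  "('o, 'm) category \<Rightarrow> ('p, 'n) category \<Rightarrow> ('o \<Rightarrow> 'p) \<Rightarrow> ('o \<Rightarrow> 'o \<Rightarrow> 'm \<Rightarrow> 'n) \<Rightarrow> bool" where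
  "contravariant_functor C D Fo Fm \<longleftrightarrow>
     (\<forall>a\<in>Obj C. Fo a \<in> Obj D) \<and>
     (\<forall>a\<in>Obj C. \<forall>b\<in>Obj C. \<forall>f\<in>Hom C a b. Fm a b f \<in> Hom D (Fo b) (Fo a)) \<and>
     (\<forall>a\<in>Obj C. Fm a a (Id C a) = Id D (Fo a)) \<and>
     (\<forall>a\<in>Obj C. \<forall>b\<in>Obj C. \<forall>c\<in>Obj C. \<forall>f\<in>Hom C a b. \<forall>g\<in>Hom C b c.
        Fm a c (Comp C a b c g f) = Comp D (Fo c) (Fo b) (Fo a) (Fm a b f) (Fm b c g))"


section \<open>Compact regular frames\<close>

definition is_frame :: "'a gorder \<Rightarrow> bool" where
  "is_frame L \<longleftrightarrow> complete_lattice L \<and>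
     (\<forall>a\<in>carrier L. \<forall>S. S \<subseteq> carrier L \<longrightarrow>
        a \<sqinter>\<^bsub>L\<^esub> (\<Squnion>\<^bsub>L\<^esub> S) = \<Squnion>\<^bsub>L\<^esub> {a \<sqinter>\<^bsub>L\<^esub> s | s. s \<in> S})"

text \<open>
  Homomorphisms are extensional on the carrier, so that they are equal as HOL functions iff
  they agree on the carrier.  Source and target may live on different types.
\<close>

definition frame_homs :: "'a gorder \<Rightarrow> 'b gorder \<Rightarrow> ('a \<Rightarrow> 'b) set" where
  "frame_homs L M = {f \<in> carrier L \<rightarrow>\<^sub>E carrier M.
     f \<top>\<^bsub>L\<^esub> = \<top>\<^bsub>M\<^esub> \<and>
     (\<forall>a\<in>carrier L. \<forall>b\<in>carrier L. f (a \<sqinter>\<^bsub>L\<^esub> b) = f a \<sqinter>\<^bsub>M\<^esub> f b) \<and>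
     (\<forall>S. S \<subseteq> carrier L \<longrightarrow> f (\<Squnion>\<^bsub>L\<^esub> S) = \<Squnion>\<^bsub>M\<^esub> (f ` S))}"

definition compact_frame :: "'a gorder \<Rightarrow> bool" where
  "compact_frame L \<longleftrightarrow>
     (\<forall>S. S \<subseteq> carrier L \<and> \<top>\<^bsub>L\<^esub> = \<Squnion>\<^bsub>L\<^esub> S \<longrightarrow> (\<exists>T. T \<subseteq> S \<and> finite T \<and> \<top>\<^bsub>L\<^esub> = \<Squnion>\<^bsub>L\<^esub> T))"

definition pseudocomplement :: "'a gorder \<Rightarrow> 'a \<Rightarrow> 'a" where
  "pseudocomplement L a = \<Squnion>\<^bsub>L\<^esub> {x \<in> carrier L. a \<sqinter>\<^bsub>L\<^esub> x = \<bottom>\<^bsub>L\<^esub>}"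

definition well_inside :: "'a gorder \<Rightarrow> 'a \<Rightarrow> 'a \<Rightarrow> bool" where
  "well_inside L a b \<longleftrightarrow> pseudocomplement L a \<squnion>\<^bsub>L\<^esub> b = \<top>\<^bsub>L\<^esub>"

definition regular_frame :: "'a gorder \<Rightarrow> bool" where
  "regular_frame L \<longleftrightarrow> (\<forall>a\<in>carrier L. a = \<Squnion>\<^bsub>L\<^esub> {b \<in> carrier L. well_inside L b a})"

definition KRFrm :: "('a gorder, 'a \<Rightarrow> 'a) category" where
  "KRFrm = \<lparr>
     Obj = {L. is_frame L \<and> compact_frame L \<and> regular_frame L},
     Hom = frame_homs,
     Comp = (\<lambda>L M N g f. compose (carrier L) g f),
     Id = (\<lambda>L. \<lambda>x\<in>carrier L. x)\<rparr>"


section \<open>KRL-spaces\<close>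

record 'a ordered_space =
  topo :: "'a topology"
  ord :: "'a rel"

abbreviation pts :: "'a ordered_space \<Rightarrow> 'a set" where
  "pts X \<equiv> topspace (topo X)"

definition up :: "'a ordered_space \<Rightarrow> 'a set \<Rightarrow> 'a set" where
  "up X S = {y \<in> pts X. \<exists>x\<in>S. (x, y) \<in> ord X}"

definition down :: "'a ordered_space \<Rightarrow> 'a set \<Rightarrow> 'a set" where
  "down X S = {y \<in> pts X. \<exists>x\<in>S. (y, x) \<in> ord X}"

definition upset :: "'a ordered_space \<Rightarrow> 'a set \<Rightarrow> bool" where
  "upset X S \<longleftrightarrow> S \<subseteq> pts X \<and> S = up X S"

definition minimals :: "'a ordered_space \<Rightarrow> 'a set \<Rightarrow> 'a set" where
  "minimals X S = {x \<in> S. \<forall>y\<in>S. (y, x) \<in> ord X \<longrightarrow> y = x}"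

definition clopenin :: "'a topology \<Rightarrow> 'a set \<Rightarrow> bool" where
  "clopenin T U \<longleftrightarrow> openin T U \<and> closedin T U"

definition ClopUp :: "'a ordered_space \<Rightarrow> 'a set set" where
  "ClopUp X = {U. clopenin (topo X) U \<and> upset X U}"

definition priestley_space :: "'a ordered_space \<Rightarrow> bool" where
  "priestley_space X \<longleftrightarrow> compact_space (topo X) \<and> partial_order_on (pts X) (ord X) \<and>
     (\<forall>x\<in>pts X. \<forall>y\<in>pts X. (x, y) \<notin> ord X \<longrightarrow> (\<exists>U\<in>ClopUp X. x \<in> U \<and> y \<notin> U))"

definition esakia_space :: "'a ordered_space \<Rightarrow> bool" where
  "esakia_space X \<longleftrightarrow> priestley_space X \<and>
     (\<forall>U. clopenin (topo X) U \<longrightarrow> clopenin (topo X) (down X U))"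

definition L_space :: "'a ordered_space \<Rightarrow> bool" where
  "L_space X \<longleftrightarrow> esakia_space X \<and>
     (\<forall>U. openin (topo X) U \<and> upset X U \<longrightarrow> openin (topo X) (topo X closure_of U))"

definition L_morphisms :: "'a ordered_space \<Rightarrow> 'b ordered_space \<Rightarrow> ('a \<Rightarrow> 'b) set" where
  "L_morphisms X Y = {f \<in> pts X \<rightarrow>\<^sub>E pts Y.
     continuous_map (topo X) (topo Y) f \<and>
     (\<forall>x y. (x, y) \<in> ord X \<longrightarrow> (f x, f y) \<in> ord Y) \<and>
     (\<forall>U. openin (topo Y) U \<and> upset Y U \<longrightarrow>
        {x \<in> pts X. f x \<in> topo Y closure_of U} = topo X closure_of {x \<in> pts X. f x \<in> U})}"

definition localic_part :: "'a ordered_space \<Rightarrow> 'a set" where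
  "localic_part X = {y \<in> pts X. clopenin (topo X) (down X {y})}"

definition scott_upset :: "'a ordered_space \<Rightarrow> 'a set \<Rightarrow> bool" where
  "scott_upset X F \<longleftrightarrow> closedin (topo X) F \<and> upset X F \<and> minimals X F \<subseteq> localic_part X"

definition L_compact :: "'a ordered_space \<Rightarrow> bool" where
  "L_compact X \<longleftrightarrow> scott_upset X (pts X)"

definition reg :: "'a ordered_space \<Rightarrow> 'a set \<Rightarrow> 'a set" where
  "reg X U = \<Union>{V \<in> ClopUp X. down X V \<subseteq> U}"

text \<open>
  Density of the regular part in \<open>U\<close> is density in the subspace \<open>U\<close>
  (note that \<open>reg X U \<subseteq> U\<close>, since \<open>V \<subseteq> down X V\<close>).
\<close>

definition L_regular :: "'a ordered_space \<Rightarrow> bool" where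
  "L_regular X \<longleftrightarrow>
     (\<forall>U\<in>ClopUp X. subtopology (topo X) U closure_of reg X U = U)"

definition KRL_space :: "'a ordered_space \<Rightarrow> bool" where
  "KRL_space X \<longleftrightarrow> L_space X \<and> L_compact X \<and> L_regular X"

definition KRLPries :: "('a ordered_space, 'a \<Rightarrow> 'a) category" where
  "KRLPries = \<lparr>
     Obj = {X. KRL_space X},
     Hom = L_morphisms,
     Comp = (\<lambda>X Y Z g f. compose (pts X) g f),
     Id = (\<lambda>X. \<lambda>x\<in>pts X. x)\<rparr>"


section \<open>The two functors of Priestley duality\<close>

definition prime_filters :: "'a gorder \<Rightarrow> 'a set set" where
  "prime_filters L = {P. P \<subseteq> carrier L \<and> \<top>\<^bsub>L\<^esub> \<in> P \<and> \<bottom>\<^bsub>L\<^esub> \<notin> P \<and>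
     (\<forall>a\<in>P. \<forall>b\<in>carrier L. a \<sqsubseteq>\<^bsub>L\<^esub> b \<longrightarrow> b \<in> P) \<and>
     (\<forall>a\<in>P. \<forall>b\<in>P. a \<sqinter>\<^bsub>L\<^esub> b \<in> P) \<and>
     (\<forall>a\<in>carrier L. \<forall>b\<in>carrier L. a \<squnion>\<^bsub>L\<^esub> b \<in> P \<longrightarrow> a \<in> P \<or> b \<in> P)}"

definition spec_obj :: "'a gorder \<Rightarrow> 'a set ordered_space" where
  "spec_obj L = \<lparr>
     topo = topology_generated_by
       ((\<lambda>a. {P \<in> prime_filters L. a \<in> P}) ` carrier L \<union>
        (\<lambda>a. {P \<in> prime_filters L. a \<notin> P}) ` carrier L),
     ord = {(P, Q). P \<in> prime_filters L \<and> Q \<in> prime_filters L \<and> P \<subseteq> Q}\<rparr>"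

definition spec_mor :: "'a gorder \<Rightarrow> 'b gorder \<Rightarrow> ('a \<Rightarrow> 'b) \<Rightarrow> 'b set \<Rightarrow> 'a set" where
  "spec_mor L M h = (\<lambda>P\<in>prime_filters M. {a \<in> carrier L. h a \<in> P})"

definition clop_obj :: "'a ordered_space \<Rightarrow> 'a set gorder" where
  "clop_obj X = \<lparr>carrier = ClopUp X, eq = (=), le = (\<subseteq>)\<rparr>"

definition clop_mor ::
  "'a ordered_space \<Rightarrow> 'b ordered_space \<Rightarrow> ('a \<Rightarrow> 'b) \<Rightarrow> 'b set \<Rightarrow> 'a set" where
  "clop_mor X Y f = (\<lambda>U\<in>ClopUp Y. {x \<in> pts X. f x \<in> U})"


section \<open>Isomorphisms and natural isomorphisms with the identity\<close>

text \<open>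
  A HOL type is in general not closed under passing from a frame to its prime filters, so
  \<open>KRFrm\<close> and \<open>KRLPries\<close> are families of categories indexed by the type carrying the objects,
  and the composites of the two functors raise a type \<open>'a\<close> to \<open>'a set set\<close>.  An isomorphism
  between objects on different types is, as usual, a morphism with a two-sided inverse
  morphism.  In the two definitions of natural isomorphism, \<open>T\<close> is an endofunctor
  up to this change of type, with object part \<open>To\<close> and morphism part \<open>Tm\<close>.
\<close>

definition frame_iso :: "'a gorder \<Rightarrow> 'b gorder \<Rightarrow> ('a \<Rightarrow> 'b) \<Rightarrow> bool" where
  "frame_iso L M f \<longleftrightarrow> f \<in> frame_homs L M \<and>
     (\<exists>g\<in>frame_homs M L. compose (carrier L) g f = (\<lambda>x\<in>carrier L. x) \<and>
                          compose (carrier M) f g = (\<lambda>y\<in>carrier M. y))"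

definition L_iso :: "'a ordered_space \<Rightarrow> 'b ordered_space \<Rightarrow> ('a \<Rightarrow> 'b) \<Rightarrow> bool" where
  "L_iso X Y f \<longleftrightarrow> f \<in> L_morphisms X Y \<and>
     (\<exists>g\<in>L_morphisms Y X. compose (pts X) g f = (\<lambda>x\<in>pts X. x) \<and>
                           compose (pts Y) f g = (\<lambda>y\<in>pts Y. y))"

definition KRFrm_naturally_iso_id ::
  "('a gorder \<Rightarrow> 'b gorder) \<Rightarrow> ('a gorder \<Rightarrow> 'a gorder \<Rightarrow> ('a \<Rightarrow> 'a) \<Rightarrow> ('b \<Rightarrow> 'b)) \<Rightarrow> bool" where
  "KRFrm_naturally_iso_id To Tm \<longleftrightarrow> (\<exists>\<eta>.
     (\<forall>L\<in>Obj KRFrm. frame_iso L (To L) (\<eta> L)) \<and>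
     (\<forall>L\<in>Obj KRFrm. \<forall>M\<in>Obj KRFrm. \<forall>f\<in>Hom KRFrm L M.
        compose (carrier L) (\<eta> M) f = compose (carrier L) (Tm L M f) (\<eta> L)))"

definition KRLPries_naturally_iso_id ::
  "('a ordered_space \<Rightarrow> 'b ordered_space) \<Rightarrow>
   ('a ordered_space \<Rightarrow> 'a ordered_space \<Rightarrow> ('a \<Rightarrow> 'a) \<Rightarrow> ('b \<Rightarrow> 'b)) \<Rightarrow> bool" where
  "KRLPries_naturally_iso_id To Tm \<longleftrightarrow> (\<exists>\<epsilon>.
     (\<forall>X\<in>Obj KRLPries. L_iso X (To X) (\<epsilon> X)) \<and>
     (\<forall>X\<in>Obj KRLPries. \<forall>Y\<in>Obj KRLPries. \<forall>f\<in>Hom KRLPries X Y.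
        compose (pts X) (\<epsilon> Y) f = compose (pts X) (Tm X Y f) (\<epsilon> X)))"

end

theory Submission
  imports Defs "HOL-Analysis.Function_Topology"
begin

text \<open>
  The equivalence is Priestley duality, cut down twice.  A frame \<open>L\<close> is sent to its prime
  filters, with \<open>\<phi> a\<close> the set of prime filters that contain \<open>a\<close>; a space \<open>X\<close> is sent to its
  clopen upsets.  That nothing is lost on the way from \<open>L\<close> to clopen upsets has two reasons.
  Prime filters separate elements (\<open>prime_filter_separation\<close>, by Zorn's lemma), so \<open>\<phi>\<close> is an
  order embedding; and the prime filters form a compact space in which the sets \<open>\<phi> a\<close> are a
  lattice separating the points, so compactness forces every clopen upset to be a \<open>\<phi> a\<close>
  (\<open>ClopUp_eq_separating_lattice\<close>).  On the way from \<open>X\<close> to prime filters, compactness turns each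
  prime filter of clopen upsets into a point (\<open>point_filter_surj\<close>).

  The infinitary structure of a frame is matched by closures.  The downset of \<open>\<phi> a - \<phi> b\<close> is the
  complement of \<open>\<phi>\<close> of the Heyting implication, which gives the Esakia condition, and
  the closure of a union of sets \<open>\<phi> a\<close> is \<open>\<phi>\<close> of the join (\<open>closure_Union_\<phi>\<close>), which makes the
  closure of an open upset open.  Conversely, in an L-space the join of a family of clopen
  upsets is the closure of its union, so that preserving joins means for preimages exactly what
  is asked of an L-morphism.

  Finally, both restrictions can be read off from the frame of clopen upsets of an L-space.
  Regularity: the pseudocomplement of \<open>V\<close> is the complement of its downset, so \<open>V\<close> is well inside
  \<open>U\<close> iff the downset of \<open>V\<close> lies in \<open>U\<close>, and the join of all such \<open>V\<close> is the closure of the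
  regular part of \<open>U\<close>.  Compactness: it says that no proper open upset is dense, and since every
  point lies above a minimal one, this is the case iff the minimal points are isolated, that is,
  iff they belong to the localic part.  As \<open>\<phi>\<close> is an isomorphism from \<open>L\<close> onto the clopen upsets of
  its space of prime filters, \<open>L\<close> is compact and regular iff that space is a KRL-space.
\<close>

section \<open>Frames and their prime filters\<close>

locale frame = complete_lattice L for L :: "'a gorder" (structure) +
  assumes meet_Sup_distrib:
    "\<lbrakk>a \<in> carrier L; S \<subseteq> carrier L\<rbrakk> \<Longrightarrow> a \<sqinter> (\<Squnion>S) = \<Squnion>{a \<sqinter> s | s. s \<in> S}"

lemma frame_iff_is_frame: "frame L \<longleftrightarrow> is_frame L"
  unfolding is_frame_def frame_def frame_axioms_def by blast

context complete_lattice
begin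

lemma le_meet_iff:
  assumes "x \<in> carrier L" "a \<in> carrier L" "b \<in> carrier L"
  shows "x \<sqsubseteq> a \<sqinter> b \<longleftrightarrow> x \<sqsubseteq> a \<and> x \<sqsubseteq> b"
  using assms by (meson le_trans meet_closed meet_le meet_left meet_right)

lemma join_le_iff:
  assumes "x \<in> carrier L" "a \<in> carrier L" "b \<in> carrier L"
  shows "a \<squnion> b \<sqsubseteq> x \<longleftrightarrow> a \<sqsubseteq> x \<and> b \<sqsubseteq> x"
  using assms by (meson le_trans join_closed join_le join_left join_right)

lemma Sup_le_iff:
  assumes "x \<in> carrier L" "S \<subseteq> carrier L"
  shows "\<Squnion>S \<sqsubseteq> x \<longleftrightarrow> (\<forall>s\<in>S. s \<sqsubseteq> x)"
  using assms by (meson le_trans subsetD sup_closed sup_least sup_upper)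

lemma le_Inf_iff:
  assumes "x \<in> carrier L" "S \<subseteq> carrier L"
  shows "x \<sqsubseteq> \<Sqinter>S \<longleftrightarrow> (\<forall>s\<in>S. x \<sqsubseteq> s)"
  using assms by (meson le_trans subsetD inf_closed inf_greatest inf_lower)

lemma Sup_eqI:
  assumes "x \<in> carrier L" "S \<subseteq> carrier L" "\<And>s. s \<in> S \<Longrightarrow> s \<sqsubseteq> x"
    "\<And>y. \<lbrakk>y \<in> carrier L; \<And>s. s \<in> S \<Longrightarrow> s \<sqsubseteq> y\<rbrakk> \<Longrightarrow> x \<sqsubseteq> y"
  shows "\<Squnion>S = x"
  by (meson assms le_antisym sup_closed sup_least sup_upper)

lemma meet_eqI:
  assumes "x \<in> carrier L" "a \<in> carrier L" "b \<in> carrier L" "x \<sqsubseteq> a" "x \<sqsubseteq> b"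
    "\<And>y. \<lbrakk>y \<in> carrier L; y \<sqsubseteq> a; y \<sqsubseteq> b\<rbrakk> \<Longrightarrow> y \<sqsubseteq> x"
  shows "a \<sqinter> b = x"
  by (meson assms le_antisym meet_closed meet_le meet_left meet_right)

lemma join_eqI:
  assumes "x \<in> carrier L" "a \<in> carrier L" "b \<in> carrier L" "a \<sqsubseteq> x" "b \<sqsubseteq> x"
    "\<And>y. \<lbrakk>y \<in> carrier L; a \<sqsubseteq> y; b \<sqsubseteq> y\<rbrakk> \<Longrightarrow> x \<sqsubseteq> y"
  shows "a \<squnion> b = x"
  by (meson assms le_antisym join_closed join_le join_left join_right)

lemma topI: "\<lbrakk>t \<in> carrier L; \<And>x. x \<in> carrier L \<Longrightarrow> x \<sqsubseteq> t\<rbrakk> \<Longrightarrow> \<top> = t"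
  by (meson le_antisym top_closed top_higher)

lemma bottomI: "\<lbrakk>t \<in> carrier L; \<And>x. x \<in> carrier L \<Longrightarrow> t \<sqsubseteq> x\<rbrakk> \<Longrightarrow> \<bottom> = t"
  by (meson le_antisym bottom_closed bottom_lower)

end

lemma prime_filtersD:
  assumes "P \<in> prime_filters L"
  shows "P \<subseteq> carrier L" "\<top>\<^bsub>L\<^esub> \<in> P" "\<bottom>\<^bsub>L\<^esub> \<notin> P"
    "\<And>a b. \<lbrakk>a \<in> P; b \<in> carrier L; a \<sqsubseteq>\<^bsub>L\<^esub> b\<rbrakk> \<Longrightarrow> b \<in> P"
    "\<And>a b. \<lbrakk>a \<in> P; b \<in> P\<rbrakk> \<Longrightarrow> a \<sqinter>\<^bsub>L\<^esub> b \<in> P"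
    "\<And>a b. \<lbrakk>a \<in> carrier L; b \<in> carrier L; a \<squnion>\<^bsub>L\<^esub> b \<in> P\<rbrakk> \<Longrightarrow> a \<in> P \<or> b \<in> P"
  using assms unfolding prime_filters_def by blast+

context frame
begin

lemma meet_Sup_le:
  assumes "a \<in> carrier L" "d \<in> carrier L" "S \<subseteq> carrier L" "\<And>s. s \<in> S \<Longrightarrow> a \<sqinter> s \<sqsubseteq> d"
  shows "a \<sqinter> \<Squnion>S \<sqsubseteq> d"
proof -
  have "{a \<sqinter> s | s. s \<in> S} \<subseteq> carrier L" using assms by auto
  then show ?thesis
    unfolding meet_Sup_distrib[OF assms(1,3)] using assms(2,4) by (auto simp: Sup_le_iff)
qed

lemma meet_join_le:
  assumes "a \<in> carrier L" "b \<in> carrier L" "c \<in> carrier L" "d \<in> carrier L"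
    "a \<sqinter> b \<sqsubseteq> d" "a \<sqinter> c \<sqsubseteq> d"
  shows "a \<sqinter> (b \<squnion> c) \<sqsubseteq> d"
  unfolding join_def using assms by (intro meet_Sup_le) auto

lemma meet_in_prime_filter_iff:
  assumes "P \<in> prime_filters L" "a \<in> carrier L" "b \<in> carrier L"
  shows "a \<sqinter> b \<in> P \<longleftrightarrow> a \<in> P \<and> b \<in> P"
  using prime_filtersD[OF assms(1)] assms by (meson meet_closed meet_left meet_right)

lemma join_in_prime_filter_iff:
  assumes "P \<in> prime_filters L" "a \<in> carrier L" "b \<in> carrier L"
  shows "a \<squnion> b \<in> P \<longleftrightarrow> a \<in> P \<or> b \<in> P"
  using prime_filtersD[OF assms(1)] assms by (meson join_closed join_left join_right)

lemma Inf_in_prime_filter: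
  assumes "P \<in> prime_filters L" "finite T" "T \<subseteq> P"
  shows "\<Sqinter>T \<in> P"
  using assms(2,3)
proof (induction T)
  case empty
  have "\<top> = \<Sqinter>{}" by (rule topI) (auto simp: le_Inf_iff)
  then show ?case using prime_filtersD(2)[OF assms(1)] by simp
next
  case (insert a T)
  note P = prime_filtersD[OF assms(1)]
  have c: "a \<in> carrier L" "T \<subseteq> carrier L" using insert.prems P(1) by auto
  have "a \<sqinter> \<Sqinter>T \<in> P" using insert P(5) by auto
  moreover have "a \<sqinter> \<Sqinter>T \<sqsubseteq> \<Sqinter>(insert a T)"
    using c by (subst le_Inf_iff) (auto intro: meet_left le_trans[OF meet_right] inf_lower)
  ultimately show ?case using P(4) c by (meson inf_closed insert_subset)
qed

lemma Sup_in_prime_filter: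
  assumes "P \<in> prime_filters L" "finite T" "T \<subseteq> carrier L" "\<Squnion>T \<in> P"
  shows "\<exists>a\<in>T. a \<in> P"
  using assms(2-4)
proof (induction T)
  case empty
  have "\<bottom> = \<Squnion>{}" by (rule bottomI) (auto simp: Sup_le_iff)
  then show ?case using prime_filtersD(3)[OF assms(1)] empty by simp
next
  case (insert a T)
  note P = prime_filtersD[OF assms(1)]
  have c: "a \<in> carrier L" "T \<subseteq> carrier L" using insert.prems P(1) by auto
  have "\<Squnion>(insert a T) \<sqsubseteq> a \<squnion> \<Squnion>T"
    using c by (subst Sup_le_iff) (auto intro: join_left le_trans[OF _ join_right] sup_upper)
  then have "a \<squnion> \<Squnion>T \<in> P" using insert.prems P(4) c by auto
  then show ?case using P(6) c insert by (metis insert_iff sup_closed)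
qed

definition lattice_filter :: "'a set \<Rightarrow> bool" where
  "lattice_filter F \<longleftrightarrow> F \<subseteq> carrier L \<and> \<top> \<in> F \<and>
     (\<forall>a\<in>F. \<forall>b\<in>carrier L. a \<sqsubseteq> b \<longrightarrow> b \<in> F) \<and> (\<forall>a\<in>F. \<forall>b\<in>F. a \<sqinter> b \<in> F)"

definition lattice_ideal :: "'a set \<Rightarrow> bool" where
  "lattice_ideal I \<longleftrightarrow> I \<subseteq> carrier L \<and> \<bottom> \<in> I \<and>
     (\<forall>a\<in>I. \<forall>b\<in>carrier L. b \<sqsubseteq> a \<longrightarrow> b \<in> I) \<and> (\<forall>a\<in>I. \<forall>b\<in>I. a \<squnion> b \<in> I)"

lemma lattice_filterI:
  assumes "F \<subseteq> carrier L" "\<top> \<in> F" "\<And>a b. \<lbrakk>a \<in> F; b \<in> carrier L; a \<sqsubseteq> b\<rbrakk> \<Longrightarrow> b \<in> F"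
    "\<And>a b. \<lbrakk>a \<in> F; b \<in> F\<rbrakk> \<Longrightarrow> a \<sqinter> b \<in> F"
  shows "lattice_filter F"
  unfolding lattice_filter_def by (intro conjI ballI impI) (rule assms; assumption)+

lemma lattice_idealI:
  assumes "I \<subseteq> carrier L" "\<bottom> \<in> I" "\<And>a b. \<lbrakk>a \<in> I; b \<in> carrier L; b \<sqsubseteq> a\<rbrakk> \<Longrightarrow> b \<in> I"
    "\<And>a b. \<lbrakk>a \<in> I; b \<in> I\<rbrakk> \<Longrightarrow> a \<squnion> b \<in> I"
  shows "lattice_ideal I"
  unfolding lattice_ideal_def by (intro conjI ballI impI) (rule assms; assumption)+

lemma lattice_filterD:
  assumes "lattice_filter F"
  shows "F \<subseteq> carrier L" "\<top> \<in> F" "\<And>a b. \<lbrakk>a \<in> F; b \<in> carrier L; a \<sqsubseteq> b\<rbrakk> \<Longrightarrow> b \<in> F"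
    "\<And>a b. \<lbrakk>a \<in> F; b \<in> F\<rbrakk> \<Longrightarrow> a \<sqinter> b \<in> F"
  using assms unfolding lattice_filter_def by blast+

lemma lattice_idealD:
  assumes "lattice_ideal I"
  shows "I \<subseteq> carrier L" "\<bottom> \<in> I" "\<And>a b. \<lbrakk>a \<in> I; b \<in> carrier L; b \<sqsubseteq> a\<rbrakk> \<Longrightarrow> b \<in> I"
    "\<And>a b. \<lbrakk>a \<in> I; b \<in> I\<rbrakk> \<Longrightarrow> a \<squnion> b \<in> I"
  using assms unfolding lattice_ideal_def by blast+

text \<open>
  This enlargement of a filter serves twice: it contradicts maximality in the prime filter
  theorem, and it produces the prime filters above a given one in the computation of downsets.
\<close>

lemma lattice_filter_adjoin:
  assumes F: "lattice_filter F" and a: "a \<in> carrier L"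
  shows "lattice_filter {x \<in> carrier L. \<exists>m\<in>F. m \<sqinter> a \<sqsubseteq> x}" (is "lattice_filter ?G")
    and "F \<subseteq> {x \<in> carrier L. \<exists>m\<in>F. m \<sqinter> a \<sqsubseteq> x}"
    and "a \<in> {x \<in> carrier L. \<exists>m\<in>F. m \<sqinter> a \<sqsubseteq> x}"
proof -
  note F' = lattice_filterD[OF F]
  show "F \<subseteq> ?G" using F'(1) a meet_left[of _ a] by blast
  show "a \<in> ?G" using F'(1,2) a meet_right[of \<top> a] by blast
  have "x \<sqinter> y \<in> ?G" if xy: "x \<in> ?G" "y \<in> ?G" for x y
  proof -
    obtain m n where mn: "m \<in> F" "n \<in> F" "m \<sqinter> a \<sqsubseteq> x" "n \<sqinter> a \<sqsubseteq> y"
      using xy by blast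
    have c: "m \<in> carrier L" "n \<in> carrier L" "x \<in> carrier L" "y \<in> carrier L"
      using mn F'(1) xy by auto
    have "(m \<sqinter> n) \<sqinter> a \<sqsubseteq> m \<sqinter> a" "(m \<sqinter> n) \<sqinter> a \<sqsubseteq> n \<sqinter> a"
      using c a by (auto simp: le_meet_iff intro: meet_right le_trans[OF meet_left] meet_left)
    then have "(m \<sqinter> n) \<sqinter> a \<sqsubseteq> x \<sqinter> y"
      using c a mn by (auto simp: le_meet_iff[of _ x y] intro: le_trans)
    then show ?thesis using F'(4)[OF mn(1,2)] c by auto
  qed
  moreover have "y \<in> ?G" if xy: "x \<in> ?G" "y \<in> carrier L" "x \<sqsubseteq> y" for x y
  proof -
    obtain m where m: "m \<in> F" "m \<sqinter> a \<sqsubseteq> x" "x \<in> carrier L" using xy(1) by blast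
    then have "m \<sqinter> a \<sqsubseteq> y" using xy(2,3) F'(1) a le_trans[of "m \<sqinter> a" x y] by auto
    then show ?thesis using m(1) xy(2) by blast
  qed
  moreover have "\<top> \<in> ?G" using F'(2) a by (auto intro!: bexI[of _ \<top>])
  ultimately show "lattice_filter ?G" unfolding lattice_filter_def by blast
qed

text \<open>
  A filter that is maximal among the filters containing \<open>F\<close> and avoiding
  \<open>I\<close> is prime: if \<open>a\<close> and \<open>b\<close> lie outside it, then
  adjoining either one meets \<open>I\<close>, and by distributivity adjoining \<open>a
  \<squnion> b\<close> meets \<open>I\<close> as well.
\<close>

theorem prime_filter_separation:
  assumes F: "lattice_filter F" and I: "lattice_ideal I" and "F \<inter> I = {}"
  obtains P where "P \<in> prime_filters L" "F \<subseteq> P" "P \<inter> I = {}"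
proof -
  define \<A> where "\<A> = {G. lattice_filter G \<and> F \<subseteq> G \<and> G \<inter> I = {}}"
  note I' = lattice_idealD[OF I]
  have "\<exists>M\<in>\<A>. \<forall>G\<in>\<A>. M \<subseteq> G \<longrightarrow> G = M"
  proof (rule subset_Zorn_nonempty)
    show "\<A> \<noteq> {}" using assms by (auto simp: \<A>_def)
    fix C assume C: "C \<noteq> {}" "subset.chain \<A> C"
    have filt: "lattice_filter G" "F \<subseteq> G" "G \<inter> I = {}" if "G \<in> C" for G
      using C that by (auto simp: subset.chain_def \<A>_def)
    have "a \<sqinter> b \<in> \<Union>C" if ab: "a \<in> \<Union>C" "b \<in> \<Union>C" for a b
    proof -
      obtain G H where GH: "G \<in> C" "a \<in> G" "H \<in> C" "b \<in> H" using ab by blast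
      then have "G \<subseteq> H \<or> H \<subseteq> G" using C by (auto simp: subset.chain_def)
      then show ?thesis using GH lattice_filterD(4)[OF filt(1)] by blast
    qed
    moreover have "b \<in> \<Union>C" if "a \<in> \<Union>C" "b \<in> carrier L" "a \<sqsubseteq> b" for a b
      using that lattice_filterD(3)[OF filt(1)] by blast
    moreover have "\<Union>C \<subseteq> carrier L" "\<top> \<in> \<Union>C"
      using C(1) lattice_filterD(1,2)[OF filt(1)] by blast+
    ultimately have "lattice_filter (\<Union>C)"
      unfolding lattice_filter_def by blast
    moreover have "F \<subseteq> \<Union>C" using C(1) filt(2) by blast
    moreover have "\<Union>C \<inter> I = {}" using filt(3) by blast
    ultimately show "\<Union>C \<in> \<A>" unfolding \<A>_def by simp
  qed
  then obtain M where M\<A>: "M \<in> \<A>" and M_max: "\<forall>G\<in>\<A>. M \<subseteq> G \<longrightarrow> G = M" by blast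
  from M\<A> have M: "lattice_filter M" "F \<subseteq> M" "M \<inter> I = {}" unfolding \<A>_def by simp_all
  have max: "G = M" if "lattice_filter G" "F \<subseteq> G" "G \<inter> I = {}" "M \<subseteq> G" for G
    using that M_max unfolding \<A>_def by simp
  note M' = lattice_filterD[OF M(1)]
  have meets_ideal: "\<exists>m\<in>M. \<exists>i\<in>I. m \<sqinter> a \<sqsubseteq> i" if a: "a \<in> carrier L" "a \<notin> M" for a
  proof (rule ccontr)
    assume "\<not> ?thesis"
    then have "{x \<in> carrier L. \<exists>m\<in>M. m \<sqinter> a \<sqsubseteq> x} \<inter> I = {}" by blast
    then have "{x \<in> carrier L. \<exists>m\<in>M. m \<sqinter> a \<sqsubseteq> x} = M"
      using lattice_filter_adjoin[OF M(1) a(1)] M(2) by (intro max) auto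
    then show False using lattice_filter_adjoin(3)[OF M(1) a(1)] a(2) by blast
  qed
  have "a \<in> M \<or> b \<in> M" if ab: "a \<in> carrier L" "b \<in> carrier L" "a \<squnion> b \<in> M" for a b
  proof (rule ccontr)
    assume "\<not> ?thesis"
    then obtain m i n j where mn: "m \<in> M" "i \<in> I" "m \<sqinter> a \<sqsubseteq> i" "n \<in> M" "j \<in> I" "n \<sqinter> b \<sqsubseteq> j"
      using meets_ideal ab by meson
    have c: "m \<in> carrier L" "n \<in> carrier L" "i \<in> carrier L" "j \<in> carrier L"
      using mn M'(1) I'(1) by auto
    have "(m \<sqinter> n) \<sqinter> a \<sqsubseteq> m \<sqinter> a" "(m \<sqinter> n) \<sqinter> b \<sqsubseteq> n \<sqinter> b"
      using c ab by (auto simp: le_meet_iff intro: meet_right le_trans[OF meet_left] meet_left)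
    then have "(m \<sqinter> n) \<sqinter> a \<sqsubseteq> i \<squnion> j" "(m \<sqinter> n) \<sqinter> b \<sqsubseteq> i \<squnion> j"
      using c ab mn by (meson join_closed join_left join_right le_trans meet_closed)+
    then have "(m \<sqinter> n) \<sqinter> (a \<squnion> b) \<sqsubseteq> i \<squnion> j"
      using c ab by (intro meet_join_le) auto
    then have "i \<squnion> j \<in> M" using mn M' ab c by (meson join_closed)
    then show False using M(3) I'(4) mn by blast
  qed
  moreover have "\<bottom> \<notin> M" using I'(2) M(3) by blast
  ultimately have "M \<in> prime_filters L"
    using M(1) unfolding prime_filters_def lattice_filter_def by simp
  then show thesis using that M by blast
qed

lemma lattice_filter_principal: "a \<in> carrier L \<Longrightarrow> lattice_filter {x \<in> carrier L. a \<sqsubseteq> x}"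
  unfolding lattice_filter_def by (auto simp: le_meet_iff intro: le_trans)

lemma lattice_ideal_principal: "a \<in> carrier L \<Longrightarrow> lattice_ideal {x \<in> carrier L. x \<sqsubseteq> a}"
  unfolding lattice_ideal_def by (auto simp: join_le_iff intro: le_trans)

lemma lattice_filter_prime: "P \<in> prime_filters L \<Longrightarrow> lattice_filter P"
  unfolding prime_filters_def lattice_filter_def by blast

lemma le_iff_prime_filters:
  assumes "a \<in> carrier L" "b \<in> carrier L"
  shows "a \<sqsubseteq> b \<longleftrightarrow> (\<forall>P\<in>prime_filters L. a \<in> P \<longrightarrow> b \<in> P)"
proof
  show "\<forall>P\<in>prime_filters L. a \<in> P \<longrightarrow> b \<in> P" if "a \<sqsubseteq> b"
    using prime_filtersD(4)[OF _ _ assms(2) that] by blast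
  show "a \<sqsubseteq> b" if *: "\<forall>P\<in>prime_filters L. a \<in> P \<longrightarrow> b \<in> P"
  proof (rule ccontr)
    assume n: "\<not> a \<sqsubseteq> b"
    then have "{x \<in> carrier L. a \<sqsubseteq> x} \<inter> {x \<in> carrier L. x \<sqsubseteq> b} = {}"
      using assms le_trans[of a _ b] by blast
    then obtain P where "P \<in> prime_filters L" "{x \<in> carrier L. a \<sqsubseteq> x} \<subseteq> P"
      "P \<inter> {x \<in> carrier L. x \<sqsubseteq> b} = {}"
      using assms lattice_filter_principal lattice_ideal_principal
      by (meson prime_filter_separation)
    then show False using * assms by blast
  qed
qed

end

section \<open>Priestley and Esakia spaces\<close>

text \<open>
  The form in which compactness is used throughout: in each application the family consists of
  the sets obtained by removing approximations of a set from it, and a common point is a point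
  that no approximation catches.
\<close>

lemma compact_space_directed_Inter:
  assumes "compact_space T" "\<C> \<noteq> {}" "\<And>C. C \<in> \<C> \<Longrightarrow> closedin T C" "{} \<notin> \<C>"
    and "\<And>C D. \<lbrakk>C \<in> \<C>; D \<in> \<C>\<rbrakk> \<Longrightarrow> \<exists>E\<in>\<C>. E \<subseteq> C \<inter> D"
  shows "\<Inter>\<C> \<noteq> {}"
proof -
  have "\<exists>E\<in>\<C>. E \<subseteq> \<Inter>F" if "finite F" "F \<subseteq> \<C>" for F
    using that
  proof (induction F)
    case empty
    then show ?case using assms(2) by auto
  next
    case (insert C F)
    then obtain E where E: "E \<in> \<C>" "E \<subseteq> \<Inter>F" by auto
    obtain D where "D \<in> \<C>" "D \<subseteq> C \<inter> E" using assms(5)[of C E] E(1) insert.prems by auto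
    then show ?case using E(2) by (intro bexI[of _ D]) auto
  qed
  then have "\<Inter>F \<noteq> {}" if "finite F" "F \<subseteq> \<C>" for F
    using that assms(4) by (metis subset_empty)
  then show ?thesis using assms(1,3) unfolding compact_space_fip by simp
qed

lemma clopenin_simps [simp]:
  "clopenin T {}" "clopenin T (topspace T)"
  "\<lbrakk>clopenin T A; clopenin T B\<rbrakk> \<Longrightarrow> clopenin T (A \<inter> B)"
  "\<lbrakk>clopenin T A; clopenin T B\<rbrakk> \<Longrightarrow> clopenin T (A \<union> B)"
  "\<lbrakk>clopenin T A; clopenin T B\<rbrakk> \<Longrightarrow> clopenin T (A - B)"
  by (auto simp: clopenin_def openin_diff closedin_diff)

lemma clopenin_subset: "clopenin T A \<Longrightarrow> A \<subseteq> topspace T"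
  by (simp add: clopenin_def openin_subset)

locale priestley =
  fixes X :: "'a ordered_space"
  assumes priestley: "priestley_space X"
begin

lemma compact: "compact_space (topo X)"
  using priestley unfolding priestley_space_def by simp

lemma ord_subset: "(x, y) \<in> ord X \<Longrightarrow> x \<in> pts X \<and> y \<in> pts X"
  using priestley partial_order_onD(4) unfolding priestley_space_def by blast

lemma ord_refl: "x \<in> pts X \<Longrightarrow> (x, x) \<in> ord X"
  using priestley partial_order_onD(1) unfolding priestley_space_def refl_on_def by blast

lemma ord_trans: "\<lbrakk>(x, y) \<in> ord X; (y, z) \<in> ord X\<rbrakk> \<Longrightarrow> (x, z) \<in> ord X"
  using priestley partial_order_onD(2) unfolding priestley_space_def trans_def by blast

lemma ord_antisym: "\<lbrakk>(x, y) \<in> ord X; (y, x) \<in> ord X\<rbrakk> \<Longrightarrow> x = y"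
  using priestley partial_order_onD(3) unfolding priestley_space_def antisym_def by blast

lemma separation:
  "\<lbrakk>x \<in> pts X; y \<in> pts X; (x, y) \<notin> ord X\<rbrakk> \<Longrightarrow> \<exists>U\<in>ClopUp X. x \<in> U \<and> y \<notin> U"
  using priestley unfolding priestley_space_def by blast

lemma upset_iff: "upset X S \<longleftrightarrow> S \<subseteq> pts X \<and> (\<forall>x\<in>S. \<forall>y. (x, y) \<in> ord X \<longrightarrow> y \<in> S)"
  unfolding upset_def up_def using ord_subset ord_refl by blast

lemma ClopUp_iff:
  "U \<in> ClopUp X \<longleftrightarrow> clopenin (topo X) U \<and> (\<forall>x\<in>U. \<forall>y. (x, y) \<in> ord X \<longrightarrow> y \<in> U)"
  unfolding ClopUp_def by (auto simp: upset_iff dest: clopenin_subset)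

lemma ClopUp_simps [simp]:
  "{} \<in> ClopUp X" "pts X \<in> ClopUp X"
  "\<lbrakk>U \<in> ClopUp X; V \<in> ClopUp X\<rbrakk> \<Longrightarrow> U \<inter> V \<in> ClopUp X"
  "\<lbrakk>U \<in> ClopUp X; V \<in> ClopUp X\<rbrakk> \<Longrightarrow> U \<union> V \<in> ClopUp X"
  using ord_subset by (auto simp: ClopUp_iff)

lemma ClopUpD:
  assumes "U \<in> ClopUp X"
  shows "clopenin (topo X) U" "openin (topo X) U" "closedin (topo X) U" "upset X U" "U \<subseteq> pts X"
    "\<And>x y. \<lbrakk>x \<in> U; (x, y) \<in> ord X\<rbrakk> \<Longrightarrow> y \<in> U"
  using assms unfolding ClopUp_iff clopenin_def upset_iff by (auto dest: openin_subset)

lemma down_Un: "down X (A \<union> B) = down X A \<union> down X B"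
  unfolding down_def by auto

lemma closedin_down_point:
  assumes "x \<in> pts X"
  shows "closedin (topo X) (down X {x})"
proof -
  have "pts X - down X {x} = \<Union>{U \<in> ClopUp X. x \<notin> U}" (is "?l = ?r")
  proof
    show "?l \<subseteq> ?r"
      using separation[OF _ assms] unfolding down_def by blast
    show "?r \<subseteq> ?l"
      using ClopUpD(5,6) unfolding down_def by blast
  qed
  moreover have "openin (topo X) ?r" by (auto intro: ClopUpD(2))
  ultimately show ?thesis unfolding closedin_def by (auto simp: down_def)
qed

text \<open>
  The sets \<open>\<phi> a\<close> of a frame form such a lattice, and so do all clopen upsets;
  treating both at once gives the neighbourhood lemma for either, and from it that the two
  coincide in the space of prime filters.
\<close>

definition separating_lattice :: "'a set set \<Rightarrow> bool" where
  "separating_lattice B \<longleftrightarrow> B \<subseteq> ClopUp X \<and> {} \<in> B \<and> pts X \<in> B \<and>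
     (\<forall>U\<in>B. \<forall>V\<in>B. U \<inter> V \<in> B \<and> U \<union> V \<in> B) \<and>
     (\<forall>x\<in>pts X. \<forall>y\<in>pts X. (x, y) \<notin> ord X \<longrightarrow> (\<exists>U\<in>B. x \<in> U \<and> y \<notin> U))"

lemma separating_latticeD:
  assumes "separating_lattice B"
  shows "B \<subseteq> ClopUp X" "{} \<in> B" "pts X \<in> B"
    "\<And>U V. \<lbrakk>U \<in> B; V \<in> B\<rbrakk> \<Longrightarrow> U \<inter> V \<in> B" "\<And>U V. \<lbrakk>U \<in> B; V \<in> B\<rbrakk> \<Longrightarrow> U \<union> V \<in> B"
    "\<And>x y. \<lbrakk>x \<in> pts X; y \<in> pts X; (x, y) \<notin> ord X\<rbrakk> \<Longrightarrow> \<exists>U\<in>B. x \<in> U \<and> y \<notin> U"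
  using assms unfolding separating_lattice_def by simp_all

lemma separating_lattice_ClopUp: "separating_lattice (ClopUp X)"
  unfolding separating_lattice_def using separation by auto

text \<open>
  The members of \<open>B\<close> that contain \<open>x\<close> are closed under intersection.
  If each of them left \<open>U\<close>, then by compactness some \<open>y\<close> outside
  \<open>U\<close> would lie in all of them, although \<open>x \<le> y\<close> fails.
\<close>

lemma open_upset_neighbourhood:
  assumes B: "separating_lattice B" and U: "openin (topo X) U" "upset X U" and x: "x \<in> U"
  shows "\<exists>V\<in>B. x \<in> V \<and> V \<subseteq> U"
proof (rule ccontr)
  assume neg: "\<not> ?thesis"
  note B' = separating_latticeD[OF B]
  have xp: "x \<in> pts X" using U(2) x unfolding upset_def by blast
  define \<C> where "\<C> = {V - U | V. V \<in> B \<and> x \<in> V}"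
  have "\<Inter>\<C> \<noteq> {}"
  proof (rule compact_space_directed_Inter[OF compact])
    show "\<C> \<noteq> {}" using B'(3) xp unfolding \<C>_def by blast
    show "closedin (topo X) C" if "C \<in> \<C>" for C
    proof -
      obtain V where V: "C = V - U" "V \<in> B" using \<open>C \<in> \<C>\<close> unfolding \<C>_def by blast
      then have "closedin (topo X) V" using B'(1) ClopUpD(3) by blast
      then show ?thesis using V U(1) by (simp add: closedin_diff)
    qed
    show "{} \<notin> \<C>" using neg unfolding \<C>_def by blast
    show "\<exists>E\<in>\<C>. E \<subseteq> C \<inter> D" if CD: "C \<in> \<C>" "D \<in> \<C>" for C D
    proof -
      obtain V W where VW: "C = V - U" "V \<in> B" "x \<in> V" "D = W - U" "W \<in> B" "x \<in> W"
        using CD unfolding \<C>_def by blast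
      then have "(V \<inter> W) - U \<in> \<C>" using B'(4) unfolding \<C>_def by blast
      then show ?thesis using VW by (intro bexI[of _ "(V \<inter> W) - U"]) auto
    qed
  qed
  then obtain y where y: "y \<in> \<Inter>\<C>" by blast
  have "pts X - U \<in> \<C>" using B'(3) xp unfolding \<C>_def by blast
  then have y': "y \<in> pts X" "y \<notin> U" using y by blast+
  then have "(x, y) \<notin> ord X" using U(2) x unfolding upset_iff by blast
  then obtain V where V: "V \<in> B" "x \<in> V" "y \<notin> V" using B'(6)[OF xp y'(1)] by blast
  then have "V - U \<in> \<C>" unfolding \<C>_def by blast
  then show False using y V(3) by blast
qed

text \<open>
  The members of \<open>B\<close> inside a clopen upset \<open>U\<close> are closed under union
  and cover \<open>U\<close>, which is compact; so one of them is \<open>U\<close>.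
\<close>

lemma ClopUp_eq_separating_lattice:
  assumes B: "separating_lattice B"
  shows "ClopUp X = B"
proof
  note B' = separating_latticeD[OF B]
  show "B \<subseteq> ClopUp X" by (rule B'(1))
  show "ClopUp X \<subseteq> B"
  proof
    fix U assume U: "U \<in> ClopUp X"
    show "U \<in> B"
    proof (rule ccontr)
      assume neg: "U \<notin> B"
      define \<C> where "\<C> = {U - V | V. V \<in> B \<and> V \<subseteq> U}"
      have "\<Inter>\<C> \<noteq> {}"
      proof (rule compact_space_directed_Inter[OF compact])
        show "\<C> \<noteq> {}" using B'(2) unfolding \<C>_def by blast
        show "closedin (topo X) C" if "C \<in> \<C>" for C
        proof -
          obtain V where V: "C = U - V" "V \<in> B" using \<open>C \<in> \<C>\<close> unfolding \<C>_def by blast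
          then have "openin (topo X) V" using B'(1) ClopUpD(2) by blast
          then show ?thesis using V ClopUpD(3)[OF U] by (simp add: closedin_diff)
        qed
        show "{} \<notin> \<C>"
        proof
          assume "{} \<in> \<C>"
          then obtain V where "V \<in> B" "V \<subseteq> U" "U - V = {}" unfolding \<C>_def by blast
          then have "V = U" by blast
          then show False using neg \<open>V \<in> B\<close> by blast
        qed
        show "\<exists>E\<in>\<C>. E \<subseteq> C \<inter> D" if CD: "C \<in> \<C>" "D \<in> \<C>" for C D
        proof -
          obtain V W where VW: "C = U - V" "V \<in> B" "V \<subseteq> U" "D = U - W" "W \<in> B" "W \<subseteq> U"
            using CD unfolding \<C>_def by blast
          then have "U - (V \<union> W) \<in> \<C>" using B'(5)[of V W] unfolding \<C>_def by blast
          then show ?thesis using VW by (intro bexI[of _ "U - (V \<union> W)"]) auto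
        qed
      qed
      then obtain y where y: "y \<in> \<Inter>\<C>" by blast
      have "U - {} \<in> \<C>" using B'(2) unfolding \<C>_def by blast
      then have "y \<in> U" using y by blast
      then obtain V where V: "V \<in> B" "y \<in> V" "V \<subseteq> U"
        using open_upset_neighbourhood[OF B ClopUpD(2,4)[OF U]] by blast
      then have "U - V \<in> \<C>" unfolding \<C>_def by blast
      then show False using y V(2) by blast
    qed
  qed
qed

text \<open>
  Differences of clopen upsets form a base: two distinct points are separated by a clopen upset
  in one of the two directions, and compactness turns the separation of \<open>x\<close> from
  the single points outside \<open>G\<close> into a separation from all of them.
\<close>

lemma basic_neighbourhood:
  assumes G: "openin (topo X) G" and x: "x \<in> G"
  shows "\<exists>V\<in>ClopUp X. \<exists>W\<in>ClopUp X. x \<in> V - W \<and> V - W \<subseteq> G"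
proof (rule ccontr)
  assume neg: "\<not> ?thesis"
  have xp: "x \<in> pts X" using openin_subset[OF G] x by blast
  define \<C> where "\<C> = {(V - W) - G | V W. V \<in> ClopUp X \<and> W \<in> ClopUp X \<and> x \<in> V - W}"
  have I: "(V - W) - G \<in> \<C>" if "V \<in> ClopUp X" "W \<in> ClopUp X" "x \<in> V" "x \<notin> W" for V W
    using that unfolding \<C>_def by blast
  have E: "\<exists>V W. C = (V - W) - G \<and> V \<in> ClopUp X \<and> W \<in> ClopUp X \<and> x \<in> V \<and> x \<notin> W" if "C \<in> \<C>" for C
    using that unfolding \<C>_def by blast
  have "\<Inter>\<C> \<noteq> {}"
  proof (rule compact_space_directed_Inter[OF compact])
    show "\<C> \<noteq> {}" using I[of "pts X" "{}"] xp by auto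
    show "closedin (topo X) C" if "C \<in> \<C>" for C
    proof -
      obtain V W where "C = (V - W) - G" "V \<in> ClopUp X" "W \<in> ClopUp X"
        using E[OF \<open>C \<in> \<C>\<close>] by blast
      then show ?thesis using G by (simp add: closedin_diff ClopUpD(2,3))
    qed
    show "{} \<notin> \<C>" using neg unfolding \<C>_def by blast
    show "\<exists>E\<in>\<C>. E \<subseteq> C \<inter> D" if "C \<in> \<C>" "D \<in> \<C>" for C D
    proof -
      obtain V W V' W' where "C = (V - W) - G" "V \<in> ClopUp X" "W \<in> ClopUp X" "x \<in> V" "x \<notin> W"
        "D = (V' - W') - G" "V' \<in> ClopUp X" "W' \<in> ClopUp X" "x \<in> V'" "x \<notin> W'"
        using E[OF \<open>C \<in> \<C>\<close>] E[OF \<open>D \<in> \<C>\<close>] by blast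
      then show ?thesis using I[of "V \<inter> V'" "W \<union> W'"]
        by (intro bexI[of _ "(V \<inter> V') - (W \<union> W') - G"]) auto
    qed
  qed
  then obtain y where y: "y \<in> \<Inter>\<C>" by blast
  have "y \<in> pts X - {} - G" using I[of "pts X" "{}"] xp y by auto
  then have yp: "y \<in> pts X" "y \<notin> G" by auto
  show False
  proof (cases "(x, y) \<in> ord X")
    case True
    then have "(y, x) \<notin> ord X" using ord_antisym yp(2) x by blast
    then obtain W where "W \<in> ClopUp X" "y \<in> W" "x \<notin> W" using separation[OF yp(1) xp] by blast
    then show False using I[of "pts X" W] xp y by auto
  next
    case False
    then obtain V where "V \<in> ClopUp X" "x \<in> V" "y \<notin> V" using separation[OF xp yp(1)] by blast
    then show False using I[of V "{}"] y by auto
  qed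
qed

text \<open>
  A clopen set is a finite union of differences of clopen upsets, phrased as an induction rule:
  the open subsets of \<open>C\<close> with property \<open>Q\<close> are closed under union and
  cover the compact set \<open>C\<close>.
\<close>

lemma clopen_induct [consumes 1, case_names empty Un basic]:
  assumes C: "clopenin (topo X) C"
    and "Q {}" "\<And>A B. \<lbrakk>Q A; Q B\<rbrakk> \<Longrightarrow> Q (A \<union> B)"
    and "\<And>V W. \<lbrakk>V \<in> ClopUp X; W \<in> ClopUp X\<rbrakk> \<Longrightarrow> Q (V - W)"
  shows "Q C"
proof (rule ccontr)
  assume neg: "\<not> Q C"
  define \<C> where "\<C> = {C - D | D. D \<subseteq> C \<and> openin (topo X) D \<and> Q D}"
  have I: "C - D \<in> \<C>" if "D \<subseteq> C" "openin (topo X) D" "Q D" for D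
    using that unfolding \<C>_def by blast
  have E: "\<exists>D. A = C - D \<and> D \<subseteq> C \<and> openin (topo X) D \<and> Q D" if "A \<in> \<C>" for A
    using that unfolding \<C>_def by blast
  have "\<Inter>\<C> \<noteq> {}"
  proof (rule compact_space_directed_Inter[OF compact])
    show "\<C> \<noteq> {}" using I[of "{}"] assms(2) by auto
    show "closedin (topo X) A" if "A \<in> \<C>" for A
      using E[OF that] C by (auto intro!: closedin_diff simp: clopenin_def)
    show "{} \<notin> \<C>"
    proof
      assume "{} \<in> \<C>"
      then obtain D where "C - D = {}" "D \<subseteq> C" "Q D" using E by metis
      then show False using neg by (metis Diff_eq_empty_iff subset_antisym)
    qed
    show "\<exists>E\<in>\<C>. E \<subseteq> A \<inter> B" if "A \<in> \<C>" "B \<in> \<C>" for A B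
    proof -
      obtain D D' where "A = C - D" "D \<subseteq> C" "openin (topo X) D" "Q D"
        "B = C - D'" "D' \<subseteq> C" "openin (topo X) D'" "Q D'"
        using E[OF \<open>A \<in> \<C>\<close>] E[OF \<open>B \<in> \<C>\<close>] by blast
      then show ?thesis using I[of "D \<union> D'"] assms(3)[of D D']
        by (intro bexI[of _ "C - (D \<union> D')"]) auto
    qed
  qed
  then obtain y where y: "y \<in> \<Inter>\<C>" by blast
  have "y \<in> C" using I[of "{}"] assms(2) y by auto
  then obtain V W where VW: "V \<in> ClopUp X" "W \<in> ClopUp X" "y \<in> V - W" "V - W \<subseteq> C"
    using basic_neighbourhood[of C y] C unfolding clopenin_def by blast
  then have "openin (topo X) (V - W)" by (simp add: openin_diff ClopUpD(2,3))
  then have "C - (V - W) \<in> \<C>" using I VW assms(4) by blast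
  then show False using y VW(3) by blast
qed

text \<open>
  Zorn's lemma for the reversed order; a chain has a lower bound because the principal downsets
  of its members are closed and nested.
\<close>

lemma minimal_below:
  assumes "x \<in> pts X"
  obtains m where "m \<in> minimals X (pts X)" "(m, x) \<in> ord X"
proof -
  define A where "A = {y. (y, x) \<in> ord X}"
  have Ap: "y \<in> pts X" if "y \<in> A" for y using that ord_subset unfolding A_def by blast
  have "\<exists>m\<in>A. \<forall>a\<in>A. (a, m) \<in> ord X \<longrightarrow> a = m"
  proof (rule predicate_Zorn)
    show "partial_order_on A (relation_of (\<lambda>a b. (b, a) \<in> ord X) A)"
      unfolding partial_order_on_def preorder_on_def refl_on_def trans_def antisym_def relation_of_def
      using ord_refl[OF Ap] ord_trans ord_antisym by blast
    fix C assume C: "C \<in> Chains (relation_of (\<lambda>a b. (b, a) \<in> ord X) A)"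
    then have CA: "C \<subseteq> A" and Cc: "\<And>a b. \<lbrakk>a \<in> C; b \<in> C\<rbrakk> \<Longrightarrow> (a, b) \<in> ord X \<or> (b, a) \<in> ord X"
      unfolding Chains_def relation_of_def by blast+
    show "\<exists>u\<in>A. \<forall>a\<in>C. (u, a) \<in> ord X"
    proof (cases "C = {}")
      case True
      have "x \<in> A" using ord_refl[OF assms] unfolding A_def by blast
      then show ?thesis using True by blast
    next
      case False
      have "\<Inter>((\<lambda>c. down X {c}) ` C) \<noteq> {}"
      proof (rule compact_space_directed_Inter[OF compact])
        show "(\<lambda>c. down X {c}) ` C \<noteq> {}" using False by blast
        show "closedin (topo X) D" if "D \<in> (\<lambda>c. down X {c}) ` C" for D
          using that closedin_down_point Ap CA by blast
        show "{} \<notin> (\<lambda>c. down X {c}) ` C"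
          using ord_refl[OF Ap] Ap CA unfolding down_def by blast
        fix D E assume DE: "D \<in> (\<lambda>c. down X {c}) ` C" "E \<in> (\<lambda>c. down X {c}) ` C"
        then obtain c d where cd: "c \<in> C" "d \<in> C" "D = down X {c}" "E = down X {d}" by blast
        have "D \<subseteq> E \<or> E \<subseteq> D"
          using Cc[OF cd(1,2)] ord_trans unfolding cd down_def by blast
        then show "\<exists>F\<in>(\<lambda>c. down X {c}) ` C. F \<subseteq> D \<inter> E" using DE by blast
      qed
      then obtain u where u: "\<And>c. c \<in> C \<Longrightarrow> u \<in> down X {c}" by blast
      then have "(u, c) \<in> ord X" if "c \<in> C" for c using that unfolding down_def by blast
      moreover have "u \<in> A" using False calculation CA ord_trans unfolding A_def by blast
      ultimately show ?thesis by blast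
    qed
  qed
  then obtain m where m: "m \<in> A" "\<And>a. \<lbrakk>a \<in> A; (a, m) \<in> ord X\<rbrakk> \<Longrightarrow> a = m" by blast
  have mx: "(m, x) \<in> ord X" using m(1) unfolding A_def by simp
  have "a = m" if "(a, m) \<in> ord X" for a
    using m(2)[OF _ that] ord_trans[OF that mx] unfolding A_def by simp
  then have "m \<in> minimals X (pts X)" using Ap[OF m(1)] unfolding minimals_def by blast
  then show thesis using that mx by blast
qed

lemma open_upset_eq_Union:
  assumes "openin (topo X) U" "upset X U"
  shows "U = \<Union>{V \<in> ClopUp X. V \<subseteq> U}"
  using open_upset_neighbourhood[OF separating_lattice_ClopUp assms] by blast

lemma Union_ClopUp:
  assumes "S \<subseteq> ClopUp X"
  shows "openin (topo X) (\<Union>S)" "upset X (\<Union>S)"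
  using assms ClopUpD(2) apply blast
  unfolding upset_iff using assms ClopUpD(5,6) by blast

end

locale esakia = priestley +
  assumes esakia: "clopenin (topo X) U \<Longrightarrow> clopenin (topo X) (down X U)"
begin

text \<open>
  If \<open>x\<close> is in the closure of an upset \<open>S\<close> and \<open>x \<le>
  y\<close>, then each clopen neighbourhood of \<open>y\<close> has an open downset, which
  contains \<open>x\<close> and hence meets \<open>S\<close>; so the neighbourhood itself meets
  \<open>S\<close>.
\<close>

lemma upset_closure:
  assumes "upset X S"
  shows "upset X (topo X closure_of S)"
  unfolding upset_iff
proof (intro conjI ballI allI impI)
  show "topo X closure_of S \<subseteq> pts X" by (rule closure_of_subset_topspace)
  fix x y assume x: "x \<in> topo X closure_of S" and xy: "(x, y) \<in> ord X"
  show "y \<in> topo X closure_of S"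
  proof (rule ccontr)
    assume n: "y \<notin> topo X closure_of S"
    have "openin (topo X) (pts X - topo X closure_of S)" by (simp add: openin_diff)
    moreover have "y \<in> pts X - topo X closure_of S" using n ord_subset[OF xy] by blast
    ultimately obtain V W where VW: "V \<in> ClopUp X" "W \<in> ClopUp X" "y \<in> V - W"
      "V - W \<subseteq> pts X - topo X closure_of S"
      using basic_neighbourhood by meson
    have "clopenin (topo X) (down X (V - W))" by (intro esakia) (simp add: VW ClopUpD(1))
    moreover have "x \<in> down X (V - W)" using xy VW(3) ord_subset[OF xy] unfolding down_def by blast
    ultimately obtain s where s: "s \<in> S" "s \<in> down X (V - W)"
      using x unfolding in_closure_of clopenin_def by blast
    then obtain v where "v \<in> V - W" "(s, v) \<in> ord X" unfolding down_def by blast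
    then have "v \<in> S" "v \<notin> topo X closure_of S" using s(1) assms VW(4) unfolding upset_iff by blast+
    then show False using assms closure_of_subset unfolding upset_def by blast
  qed
qed

end

section \<open>The frame of clopen upsets of an L-space\<close>

lemma (in partial_order) complete_lattice_of_sups:
  assumes sups: "\<And>A. A \<subseteq> carrier L \<Longrightarrow> \<exists>s. least L s (Upper L A)"
  shows "complete_lattice L"
proof
  show "\<exists>s. least L s (Upper L A)" if "A \<subseteq> carrier L" for A by (rule sups[OF that])
  show "\<exists>i. greatest L i (Lower L A)" if A: "A \<subseteq> carrier L" for A
  proof -
    obtain s where s: "least L s (Upper L (Lower L A))" using sups[of "Lower L A"] by auto
    have "greatest L s (Lower L A)"
    proof (rule greatest_LowerI)
      show "s \<sqsubseteq> x" if "x \<in> A" for x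
        using s that A by (intro least_le[OF s]) (auto intro!: Upper_memI)
      show "y \<sqsubseteq> s" if "y \<in> Lower L A" for y
        using least_Upper_above[OF s that] by simp
    qed (use A s in auto)
    then show ?thesis by blast
  qed
qed

lemma clop_obj_simps [simp]:
  "carrier (clop_obj X) = ClopUp X" "(U \<sqsubseteq>\<^bsub>clop_obj X\<^esub> V) = (U \<subseteq> V)"
  "(U .=\<^bsub>clop_obj X\<^esub> V) = (U = V)"
  by (simp_all add: clop_obj_def)

lemma partial_order_clop_obj: "partial_order (clop_obj X)"
  by unfold_locales (auto simp: clop_obj_def)

locale Lspace = esakia +
  assumes open_closure: "\<lbrakk>openin (topo X) U; upset X U\<rbrakk> \<Longrightarrow> openin (topo X) (topo X closure_of U)"

lemma Lspace_iff: "Lspace X \<longleftrightarrow> L_space X"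
  unfolding Lspace_def Lspace_axioms_def esakia_def priestley_def esakia_axioms_def
    L_space_def esakia_space_def by blast

context Lspace
begin

lemma closure_open_upset_ClopUp:
  assumes "openin (topo X) U" "upset X U"
  shows "topo X closure_of U \<in> ClopUp X"
  using open_closure[OF assms] upset_closure[OF assms(2)]
  unfolding ClopUp_def clopenin_def by simp

lemma closure_Union_ClopUp: "S \<subseteq> ClopUp X \<Longrightarrow> topo X closure_of (\<Union>S) \<in> ClopUp X"
  by (intro closure_open_upset_ClopUp Union_ClopUp)

lemma complete_lattice_clop_obj: "complete_lattice (clop_obj X)"
proof (rule partial_order.complete_lattice_of_sups[OF partial_order_clop_obj])
  fix S assume "S \<subseteq> carrier (clop_obj X)"
  then have S: "S \<subseteq> ClopUp X" by simp
  have "least (clop_obj X) (topo X closure_of (\<Union>S)) (Upper (clop_obj X) S)"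
  proof (rule least_UpperI)
    show "U \<sqsubseteq>\<^bsub>clop_obj X\<^esub> topo X closure_of (\<Union>S)" if "U \<in> S" for U
      using closure_of_subset[of "\<Union>S" "topo X"] that S ClopUpD(5) by auto
    show "topo X closure_of (\<Union>S) \<sqsubseteq>\<^bsub>clop_obj X\<^esub> V" if "V \<in> Upper (clop_obj X) S" for V
    proof -
      have "V \<in> ClopUp X" "\<And>U. U \<in> S \<Longrightarrow> U \<subseteq> V" using that S by (auto simp: Upper_def)
      then show ?thesis unfolding clop_obj_simps by (intro closure_of_minimal Union_least ClopUpD(3))
    qed
  qed (use S closure_Union_ClopUp in auto)
  then show "\<exists>s. least (clop_obj X) s (Upper (clop_obj X) S)" by blast
qed

sublocale clop: complete_lattice "clop_obj X"
  by (rule complete_lattice_clop_obj)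

lemma Sup_clop_obj: "S \<subseteq> ClopUp X \<Longrightarrow> \<Squnion>\<^bsub>clop_obj X\<^esub> S = topo X closure_of (\<Union>S)"
proof (rule clop.Sup_eqI)
  assume S: "S \<subseteq> ClopUp X"
  show "topo X closure_of (\<Union>S) \<in> carrier (clop_obj X)" "S \<subseteq> carrier (clop_obj X)"
    using S closure_Union_ClopUp by simp_all
  show "U \<sqsubseteq>\<^bsub>clop_obj X\<^esub> topo X closure_of (\<Union>S)" if "U \<in> S" for U
    using closure_of_subset[of "\<Union>S" "topo X"] that S ClopUpD(5) by auto
  show "topo X closure_of (\<Union>S) \<sqsubseteq>\<^bsub>clop_obj X\<^esub> V"
    if "V \<in> carrier (clop_obj X)" "\<And>U. U \<in> S \<Longrightarrow> U \<sqsubseteq>\<^bsub>clop_obj X\<^esub> V" for V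
    using that unfolding clop_obj_simps by (intro closure_of_minimal Union_least ClopUpD(3))
qed

lemma meet_clop_obj: "\<lbrakk>U \<in> ClopUp X; V \<in> ClopUp X\<rbrakk> \<Longrightarrow> U \<sqinter>\<^bsub>clop_obj X\<^esub> V = U \<inter> V"
  by (rule clop.meet_eqI) auto

lemma join_clop_obj: "\<lbrakk>U \<in> ClopUp X; V \<in> ClopUp X\<rbrakk> \<Longrightarrow> U \<squnion>\<^bsub>clop_obj X\<^esub> V = U \<union> V"
  by (rule clop.join_eqI) auto

lemma top_clop_obj: "\<top>\<^bsub>clop_obj X\<^esub> = pts X"
  by (rule clop.topI) (auto dest: ClopUpD(5))

lemma bottom_clop_obj: "\<bottom>\<^bsub>clop_obj X\<^esub> = {}"
  by (rule clop.bottomI) auto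

lemmas clop_obj_ops = meet_clop_obj join_clop_obj top_clop_obj bottom_clop_obj

text \<open>
  For open \<open>U\<close> the sets \<open>U \<inter> cl T\<close> and \<open>U \<inter>
  T\<close> have the same closure, and joins are closures of unions.
\<close>

theorem frame_clop_obj: "frame (clop_obj X)"
proof
  fix U S assume "U \<in> carrier (clop_obj X)" "S \<subseteq> carrier (clop_obj X)"
  then have U: "U \<in> ClopUp X" and S: "S \<subseteq> ClopUp X" by simp_all
  have eq: "{U \<sqinter>\<^bsub>clop_obj X\<^esub> V | V. V \<in> S} = {U \<inter> V | V. V \<in> S}"
    using U S meet_clop_obj by (auto simp: subset_iff) (metis)
  have sub: "{U \<inter> V | V. V \<in> S} \<subseteq> ClopUp X" using U S by auto
  have "U \<sqinter>\<^bsub>clop_obj X\<^esub> (\<Squnion>\<^bsub>clop_obj X\<^esub> S) = U \<inter> topo X closure_of (\<Union>S)"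
    using U S by (simp add: Sup_clop_obj meet_clop_obj closure_Union_ClopUp)
  also have "\<dots> = topo X closure_of (U \<inter> topo X closure_of (\<Union>S))"
    using U ClopUpD(3) by (intro closure_of_closedin[symmetric] closedin_Int) auto
  also have "\<dots> = topo X closure_of (U \<inter> \<Union>S)"
    by (rule closure_of_openin_Int_closure_of[OF ClopUpD(2)[OF U]])
  also have "U \<inter> \<Union>S = \<Union>{U \<inter> V | V. V \<in> S}" by auto
  also have "topo X closure_of \<dots> = \<Squnion>\<^bsub>clop_obj X\<^esub> {U \<sqinter>\<^bsub>clop_obj X\<^esub> V | V. V \<in> S}"
    unfolding eq by (rule Sup_clop_obj[OF sub, symmetric])
  finally show "U \<sqinter>\<^bsub>clop_obj X\<^esub> (\<Squnion>\<^bsub>clop_obj X\<^esub> S) = \<Squnion>\<^bsub>clop_obj X\<^esub> {U \<sqinter>\<^bsub>clop_obj X\<^esub> V | V. V \<in> S}" .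
qed

lemma upset_minus_down: "upset X (pts X - down X S)"
  unfolding upset_iff down_def using ord_subset ord_trans by blast

lemma pseudocomplement_clop_obj:
  assumes V: "V \<in> ClopUp X"
  shows "pseudocomplement (clop_obj X) V = pts X - down X V"
proof -
  have D: "pts X - down X V \<in> ClopUp X"
    using esakia[OF ClopUpD(1)[OF V]] upset_minus_down unfolding ClopUp_def by simp
  have eq: "{W \<in> carrier (clop_obj X). V \<sqinter>\<^bsub>clop_obj X\<^esub> W = \<bottom>\<^bsub>clop_obj X\<^esub>} = {W \<in> ClopUp X. V \<inter> W = {}}"
    using V by (auto simp: clop_obj_ops)
  have "V \<subseteq> down X V" using ord_refl ClopUpD(5)[OF V] unfolding down_def by blast
  then have mem: "pts X - down X V \<in> {W \<in> ClopUp X. V \<inter> W = {}}" using D by blast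
  have ub: "W \<subseteq> pts X - down X V" if "W \<in> ClopUp X" "V \<inter> W = {}" for W
    using ClopUpD(5,6)[OF that(1)] that(2) unfolding down_def by blast
  show ?thesis
    unfolding pseudocomplement_def eq
  proof (rule clop.Sup_eqI)
    show "pts X - down X V \<sqsubseteq>\<^bsub>clop_obj X\<^esub> Z"
      if "\<And>W. W \<in> {W \<in> ClopUp X. V \<inter> W = {}} \<Longrightarrow> W \<sqsubseteq>\<^bsub>clop_obj X\<^esub> Z" for Z
      using that[OF mem] .
  qed (use D ub in auto)
qed

lemma well_inside_clop_obj:
  assumes "V \<in> ClopUp X" "U \<in> ClopUp X"
  shows "well_inside (clop_obj X) V U \<longleftrightarrow> down X V \<subseteq> U"
proof -
  have "pts X - down X V \<in> ClopUp X"
    using esakia[OF ClopUpD(1)[OF assms(1)]] upset_minus_down unfolding ClopUp_def by simp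
  then have "well_inside (clop_obj X) V U \<longleftrightarrow> (pts X - down X V) \<union> U = pts X"
    unfolding well_inside_def pseudocomplement_clop_obj[OF assms(1)]
    using assms(2) by (simp add: clop_obj_ops)
  also have "\<dots> \<longleftrightarrow> down X V \<subseteq> U"
    using ClopUpD(5)[OF assms(2)] unfolding down_def by blast
  finally show ?thesis .
qed

text \<open>
  Both sides say that \<open>U\<close> is the closure of its regular part, because
  \<open>U\<close> is closed and contains that part.
\<close>

theorem regular_clop_obj_iff: "regular_frame (clop_obj X) \<longleftrightarrow> L_regular X"
proof -
  have "U = \<Squnion>\<^bsub>clop_obj X\<^esub> {V \<in> ClopUp X. well_inside (clop_obj X) V U} \<longleftrightarrow>
      subtopology (topo X) U closure_of reg X U = U" if U: "U \<in> ClopUp X" for U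
  proof -
    have "{V \<in> ClopUp X. well_inside (clop_obj X) V U} = {V \<in> ClopUp X. down X V \<subseteq> U}"
      using U well_inside_clop_obj by blast
    then have 1: "\<Squnion>\<^bsub>clop_obj X\<^esub> {V \<in> ClopUp X. well_inside (clop_obj X) V U} = topo X closure_of reg X U"
      unfolding reg_def using Sup_clop_obj[of "{V \<in> ClopUp X. down X V \<subseteq> U}"] by auto
    have "V \<subseteq> down X V" if "V \<in> ClopUp X" for V
      using ClopUpD(5)[OF that] ord_refl unfolding down_def by blast
    then have sub: "reg X U \<subseteq> U" unfolding reg_def by blast
    then have "topo X closure_of reg X U \<subseteq> U"
      using ClopUpD(3)[OF U] by (rule closure_of_minimal)
    then have "subtopology (topo X) U closure_of reg X U = topo X closure_of reg X U"
      using sub by (simp add: closure_of_subtopology Int_absorb1)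
    then show ?thesis using 1 by auto
  qed
  then show ?thesis unfolding regular_frame_def L_regular_def by simp
qed

lemma L_compact_iff: "L_compact X \<longleftrightarrow> minimals X (pts X) \<subseteq> localic_part X"
  unfolding L_compact_def scott_upset_def upset_iff using ord_subset by auto

lemma down_minimal: "m \<in> minimals X (pts X) \<Longrightarrow> down X {m} = {m}"
  unfolding minimals_def down_def using ord_refl by blast

text \<open>
  If \<open>m\<close> is minimal but not isolated, the complement of \<open>m\<close> is a dense
  proper open upset; the clopen upsets in it have join \<open>\<top>\<close>, but finitely many
  of them have their union as join, which misses \<open>m\<close>. If the minimal points are
  isolated, then a dense open upset contains all of them and therefore everything, and
  compactness of the space applies.
\<close>

theorem compact_clop_obj_iff: "compact_frame (clop_obj X) \<longleftrightarrow> L_compact X"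
proof
  assume comp: "compact_frame (clop_obj X)"
  show "L_compact X"
    unfolding L_compact_iff
  proof
    fix m assume m: "m \<in> minimals X (pts X)"
    then have mp: "m \<in> pts X" unfolding minimals_def by blast
    have cl: "closedin (topo X) {m}" using closedin_down_point[OF mp] down_minimal[OF m] by simp
    have "openin (topo X) {m}"
    proof (rule ccontr)
      assume not_isolated: "\<not> openin (topo X) {m}"
      define U where "U = pts X - {m}"
      have U: "openin (topo X) U" "upset X U"
        using cl m upset_minus_down[of "{m}"] down_minimal[OF m] unfolding U_def by (auto simp: openin_diff)
      define S where "S = {V \<in> ClopUp X. V \<subseteq> U}"
      have S: "S \<subseteq> ClopUp X" "\<Union>S = U"
        using open_upset_eq_Union[OF U] unfolding S_def by auto
      have "m \<in> topo X closure_of U"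
        unfolding in_closure_of
      proof (intro conjI allI impI)
        show "\<exists>y. y \<in> U \<and> y \<in> T" if T: "m \<in> T \<and> openin (topo X) T" for T
        proof (rule ccontr)
          assume "\<not> ?thesis"
          then have "T = {m}" using T openin_subset[of "topo X" T] unfolding U_def by blast
          then show False using T not_isolated by simp
        qed
      qed (rule mp)
      then have "topo X closure_of U = pts X"
        using closure_of_subset[of U "topo X"] closure_of_subset_topspace[of "topo X" U]
        unfolding U_def by blast
      then have "\<top>\<^bsub>clop_obj X\<^esub> = \<Squnion>\<^bsub>clop_obj X\<^esub> S"
        using Sup_clop_obj[OF S(1)] S(2) by (simp add: top_clop_obj)
      then obtain T where T: "T \<subseteq> S" "finite T" "\<top>\<^bsub>clop_obj X\<^esub> = \<Squnion>\<^bsub>clop_obj X\<^esub> T"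
        using comp S(1) unfolding compact_frame_def clop_obj_simps by meson
      have "closedin (topo X) (\<Union>T)"
        using T S(1) ClopUpD(3) by (intro closedin_Union) auto
      then have "\<Squnion>\<^bsub>clop_obj X\<^esub> T = \<Union>T"
        using T(1) S(1) Sup_clop_obj[of T] by (simp add: closure_of_closedin)
      then have "pts X \<subseteq> U" using T S(2) by (auto simp: top_clop_obj)
      then show False using mp unfolding U_def by blast
    qed
    then show "m \<in> localic_part X"
      using cl mp down_minimal[OF m] unfolding localic_part_def clopenin_def by simp
  qed
next
  assume L: "L_compact X"
  show "compact_frame (clop_obj X)"
    unfolding compact_frame_def clop_obj_simps
  proof (intro allI impI)
    fix S assume S: "S \<subseteq> ClopUp X \<and> \<top>\<^bsub>clop_obj X\<^esub> = \<Squnion>\<^bsub>clop_obj X\<^esub> S"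
    then have dense: "topo X closure_of (\<Union>S) = pts X"
      using Sup_clop_obj[of S] top_clop_obj by simp
    have "\<Union>S = pts X"
    proof
      show "\<Union>S \<subseteq> pts X" using S ClopUpD(5) by blast
      show "pts X \<subseteq> \<Union>S"
      proof
        fix x assume "x \<in> pts X"
        then obtain m where m: "m \<in> minimals X (pts X)" "(m, x) \<in> ord X" by (rule minimal_below)
        then have "openin (topo X) {m}" "m \<in> pts X"
          using L down_minimal[OF m(1)] unfolding L_compact_iff localic_part_def clopenin_def by auto
        then have "m \<in> \<Union>S" using dense unfolding closure_of_def by blast
        then show "x \<in> \<Union>S" using m(2) S ClopUpD(6) by blast
      qed
    qed
    moreover have "\<forall>U\<in>S. openin (topo X) U" using S ClopUpD(2) by blast
    ultimately obtain T where T: "finite T" "T \<subseteq> S" "\<Union>T = pts X"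
      using compact unfolding compact_space by meson
    then have "\<Squnion>\<^bsub>clop_obj X\<^esub> T = topo X closure_of (pts X)"
      using S Sup_clop_obj[of T] by auto
    then have "\<top>\<^bsub>clop_obj X\<^esub> = \<Squnion>\<^bsub>clop_obj X\<^esub> T"
      unfolding top_clop_obj closure_of_topspace by (rule sym)
    then show "\<exists>T\<subseteq>S. finite T \<and> \<top>\<^bsub>clop_obj X\<^esub> = \<Squnion>\<^bsub>clop_obj X\<^esub> T" using T by blast
  qed
qed

end

section \<open>Order isomorphisms of frames\<close>

text \<open>
  Extensionality makes an order isomorphism usable as a frame homomorphism without further
  restriction.
\<close>

definition order_iso :: "'a gorder \<Rightarrow> 'b gorder \<Rightarrow> ('a \<Rightarrow> 'b) \<Rightarrow> bool" where
  "order_iso L M f \<longleftrightarrow> f \<in> carrier L \<rightarrow>\<^sub>E carrier M \<and> bij_betw f (carrier L) (carrier M) \<and>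
     (\<forall>a\<in>carrier L. \<forall>b\<in>carrier L. f a \<sqsubseteq>\<^bsub>M\<^esub> f b \<longleftrightarrow> a \<sqsubseteq>\<^bsub>L\<^esub> b)"

lemma order_iso_inverse:
  assumes "order_iso L M f"
  shows "order_iso M L (restrict (inv_into (carrier L) f) (carrier M))"
proof -
  let ?g = "restrict (inv_into (carrier L) f) (carrier M)"
  have f: "bij_betw f (carrier L) (carrier M)"
    "\<And>a b. \<lbrakk>a \<in> carrier L; b \<in> carrier L\<rbrakk> \<Longrightarrow> f a \<sqsubseteq>\<^bsub>M\<^esub> f b \<longleftrightarrow> a \<sqsubseteq>\<^bsub>L\<^esub> b"
    using assms unfolding order_iso_def by blast+
  have g: "bij_betw ?g (carrier M) (carrier L)"
    using bij_betw_inv_into[OF f(1)] bij_betw_cong[of "carrier M" ?g "inv_into (carrier L) f"] by simp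
  have gf: "?g y \<in> carrier L" "f (?g y) = y" if "y \<in> carrier M" for y
    using that f(1) bij_betw_inv_into_right[OF f(1)] bij_betwE[OF g] by auto
  have "?g a \<sqsubseteq>\<^bsub>L\<^esub> ?g b \<longleftrightarrow> a \<sqsubseteq>\<^bsub>M\<^esub> b" if "a \<in> carrier M" "b \<in> carrier M" for a b
    using f(2)[OF gf(1) gf(1), OF that] gf(2) that by simp
  then show ?thesis using g gf(1) unfolding order_iso_def by (simp add: PiE_def)
qed

locale complete_lattice_iso = L: complete_lattice L + M: complete_lattice M
  for L :: "'a gorder" and M :: "'b gorder" +
  fixes f :: "'a \<Rightarrow> 'b"
  assumes iso: "order_iso L M f"
begin

lemma f_closed [simp]: "a \<in> carrier L \<Longrightarrow> f a \<in> carrier M"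
  using iso unfolding order_iso_def by auto

lemma f_image: "f ` carrier L = carrier M"
  using iso unfolding order_iso_def bij_betw_def by auto

lemma f_inj: "\<lbrakk>a \<in> carrier L; b \<in> carrier L; f a = f b\<rbrakk> \<Longrightarrow> a = b"
  using iso unfolding order_iso_def bij_betw_def inj_on_def by auto

lemma f_le: "\<lbrakk>a \<in> carrier L; b \<in> carrier L\<rbrakk> \<Longrightarrow> f a \<sqsubseteq>\<^bsub>M\<^esub> f b \<longleftrightarrow> a \<sqsubseteq>\<^bsub>L\<^esub> b"
  using iso unfolding order_iso_def by auto

lemma f_onto:
  assumes "y \<in> carrier M"
  obtains a where "a \<in> carrier L" "y = f a"
  using assms f_image by blast

lemma f_Sup:
  assumes S: "S \<subseteq> carrier L"
  shows "f (\<Squnion>\<^bsub>L\<^esub> S) = \<Squnion>\<^bsub>M\<^esub> (f ` S)"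
proof (rule M.Sup_eqI[symmetric])
  show "f ` S \<subseteq> carrier M" using S by auto
  show "y \<sqsubseteq>\<^bsub>M\<^esub> f (\<Squnion>\<^bsub>L\<^esub> S)" if "y \<in> f ` S" for y
    using that S L.sup_upper by (auto simp: f_le subset_iff)
  show "f (\<Squnion>\<^bsub>L\<^esub> S) \<sqsubseteq>\<^bsub>M\<^esub> y" if "y \<in> carrier M" and ub: "\<And>s. s \<in> f ` S \<Longrightarrow> s \<sqsubseteq>\<^bsub>M\<^esub> y" for y
  proof -
    obtain a where a: "a \<in> carrier L" "y = f a" using \<open>y \<in> carrier M\<close> by (rule f_onto)
    then have "s \<sqsubseteq>\<^bsub>L\<^esub> a" if "s \<in> S" for s using ub[of "f s"] that S f_le[of s a] by auto
    then show ?thesis using a S by (simp add: f_le L.Sup_le_iff)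
  qed
qed (use S in simp)

lemma f_meet:
  assumes ab: "a \<in> carrier L" "b \<in> carrier L"
  shows "f (a \<sqinter>\<^bsub>L\<^esub> b) = f a \<sqinter>\<^bsub>M\<^esub> f b"
proof (rule M.meet_eqI[symmetric])
  show "y \<sqsubseteq>\<^bsub>M\<^esub> f (a \<sqinter>\<^bsub>L\<^esub> b)" if "y \<in> carrier M" "y \<sqsubseteq>\<^bsub>M\<^esub> f a" "y \<sqsubseteq>\<^bsub>M\<^esub> f b" for y
  proof -
    obtain c where "c \<in> carrier L" "y = f c" using \<open>y \<in> carrier M\<close> by (rule f_onto)
    then show ?thesis using that ab by (simp add: f_le L.le_meet_iff)
  qed
qed (use ab in \<open>simp_all add: f_le L.meet_left L.meet_right\<close>)

lemma f_join: "\<lbrakk>a \<in> carrier L; b \<in> carrier L\<rbrakk> \<Longrightarrow> f (a \<squnion>\<^bsub>L\<^esub> b) = f a \<squnion>\<^bsub>M\<^esub> f b"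
  unfolding join_def by (simp add: f_Sup)

lemma f_top: "f \<top>\<^bsub>L\<^esub> = \<top>\<^bsub>M\<^esub>"
  by (rule M.topI[symmetric]) (auto simp: f_le elim!: f_onto)

lemma f_bottom: "f \<bottom>\<^bsub>L\<^esub> = \<bottom>\<^bsub>M\<^esub>"
  by (rule M.bottomI[symmetric]) (auto simp: f_le elim!: f_onto)

lemma f_frame_hom: "f \<in> frame_homs L M"
  using iso unfolding frame_homs_def order_iso_def by (auto simp: f_top f_meet f_Sup)

lemma f_pseudocomplement:
  assumes a: "a \<in> carrier L"
  shows "f (pseudocomplement L a) = pseudocomplement M (f a)"
proof -
  have iff: "f a \<sqinter>\<^bsub>M\<^esub> f x = \<bottom>\<^bsub>M\<^esub> \<longleftrightarrow> a \<sqinter>\<^bsub>L\<^esub> x = \<bottom>\<^bsub>L\<^esub>" if "x \<in> carrier L" for x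
    using that a f_inj[of "a \<sqinter>\<^bsub>L\<^esub> x" "\<bottom>\<^bsub>L\<^esub>"] by (auto simp flip: f_meet f_bottom)
  have "f ` {x \<in> carrier L. a \<sqinter>\<^bsub>L\<^esub> x = \<bottom>\<^bsub>L\<^esub>} = {y \<in> carrier M. f a \<sqinter>\<^bsub>M\<^esub> y = \<bottom>\<^bsub>M\<^esub>}"
    using iff f_image by (auto 0 3)
  then show ?thesis unfolding pseudocomplement_def by (simp add: f_Sup)
qed

lemma f_well_inside:
  assumes "a \<in> carrier L" "b \<in> carrier L"
  shows "well_inside M (f a) (f b) \<longleftrightarrow> well_inside L a b"
proof -
  have c: "pseudocomplement L a \<in> carrier L" unfolding pseudocomplement_def by simp
  then show ?thesis
    unfolding well_inside_def using assms f_inj[of "pseudocomplement L a \<squnion>\<^bsub>L\<^esub> b" "\<top>\<^bsub>L\<^esub>"]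
    by (auto simp flip: f_pseudocomplement f_join f_top)
qed

lemma regular_frame_transfer:
  assumes "regular_frame L"
  shows "regular_frame M"
  unfolding regular_frame_def
proof
  fix y assume "y \<in> carrier M"
  then obtain a where a: "a \<in> carrier L" "y = f a" by (rule f_onto)
  have "f ` {b \<in> carrier L. well_inside L b a} = {b \<in> carrier M. well_inside M b y}"
    using f_well_inside a f_image by (auto 0 3)
  moreover have "f a = f (\<Squnion>\<^bsub>L\<^esub> {b \<in> carrier L. well_inside L b a})"
    using assms a(1) unfolding regular_frame_def by (intro arg_cong[where f = f]) blast
  moreover have "{b \<in> carrier L. well_inside L b a} \<subseteq> carrier L" by blast
  ultimately show "y = \<Squnion>\<^bsub>M\<^esub> {b \<in> carrier M. well_inside M b y}"
    using a(2) by (simp only: f_Sup)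
qed

lemma compact_frame_transfer:
  assumes comp: "compact_frame L"
  shows "compact_frame M"
  unfolding compact_frame_def
proof (intro allI impI)
  fix S assume S: "S \<subseteq> carrier M \<and> \<top>\<^bsub>M\<^esub> = \<Squnion>\<^bsub>M\<^esub> S"
  then obtain R where R: "R \<subseteq> carrier L" "S = f ` R" using f_image subset_imageE by metis
  then have "f \<top>\<^bsub>L\<^esub> = f (\<Squnion>\<^bsub>L\<^esub> R)" using S by (simp only: f_Sup f_top)
  then have "\<top>\<^bsub>L\<^esub> = \<Squnion>\<^bsub>L\<^esub> R" by (intro f_inj L.top_closed L.sup_closed R(1))
  then obtain T where T: "T \<subseteq> R" "finite T" "\<top>\<^bsub>L\<^esub> = \<Squnion>\<^bsub>L\<^esub> T"
    using comp R(1) unfolding compact_frame_def by meson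
  then have "T \<subseteq> carrier L" using R(1) by blast
  moreover have "f \<top>\<^bsub>L\<^esub> = f (\<Squnion>\<^bsub>L\<^esub> T)" using T(3) by (rule arg_cong)
  ultimately have "\<top>\<^bsub>M\<^esub> = \<Squnion>\<^bsub>M\<^esub> (f ` T)" unfolding f_top using f_Sup[of T] by metis
  moreover have "f ` T \<subseteq> S" "finite (f ` T)" using T R(2) by auto
  ultimately show "\<exists>T\<subseteq>S. finite T \<and> \<top>\<^bsub>M\<^esub> = \<Squnion>\<^bsub>M\<^esub> T" by (intro exI[of _ "f ` T"] conjI)
qed

end

lemma order_iso_frame_iso:
  assumes "complete_lattice L" "complete_lattice M" "order_iso L M f"
  shows "frame_iso L M f"
proof -
  let ?g = "restrict (inv_into (carrier L) f) (carrier M)"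
  interpret f: complete_lattice_iso L M f
    using assms by (intro complete_lattice_iso.intro complete_lattice_iso_axioms.intro)
  interpret g: complete_lattice_iso M L ?g
    using assms by (intro complete_lattice_iso.intro complete_lattice_iso_axioms.intro order_iso_inverse)
  have b: "bij_betw f (carrier L) (carrier M)" using assms(3) unfolding order_iso_def by blast
  have "compose (carrier L) ?g f = (\<lambda>x\<in>carrier L. x)"
    using bij_betw_inv_into_left[OF b] by (auto simp: compose_def)
  moreover have "compose (carrier M) f ?g = (\<lambda>y\<in>carrier M. y)"
    using bij_betw_inv_into_right[OF b] by (auto simp: compose_def)
  ultimately show ?thesis
    unfolding frame_iso_def using f.f_frame_hom g.f_frame_hom by blast
qed

section \<open>The space of prime filters of a frame\<close>

text \<open>
  This identifies the generated topology with the form of it that Alexander's subbase theorem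
  refers to.
\<close>

lemma topology_generated_by_eq_subbase:
  "topology (arbitrary union_of (finite intersection_of (\<lambda>x. x \<in> B) relative_to \<Union>B)) =
     topology_generated_by B" (is "?S = ?G")
  unfolding topology_eq
proof (intro allI iffI)
  fix U
  show "openin ?G U" if "openin ?S U"
  proof (rule minimal_topology_subbase[OF _ _ that])
    show "openin ?G (\<Union>B)" by (metis openin_topspace topology_generated_by_topspace)
  qed (rule topology_generated_by_Basis)
  show "openin ?S U" if "openin ?G U"
  proof (rule generate_topology_on_coarsest)
    show "istopology (openin ?S)" by (rule istopology_openin)
    show "generate_topology_on B U" using that by (rule openin_topology_generated_by)
    show "openin ?S A" if "A \<in> B" for A
    proof -
      have "(finite intersection_of (\<lambda>x. x \<in> B)) A" using that by (rule finite_intersection_of_inc)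
      then have "(finite intersection_of (\<lambda>x. x \<in> B) relative_to \<Union>B) (\<Union>B \<inter> A)"
        by (rule relative_to_inc)
      moreover have "\<Union>B \<inter> A = A" using that by blast
      ultimately show ?thesis by (simp add: openin_subbase arbitrary_union_of_inc)
    qed
  qed
qed

lemma compact_space_generated:
  assumes "\<And>C. \<lbrakk>C \<subseteq> B; \<Union>C = \<Union>B\<rbrakk> \<Longrightarrow> \<exists>C'. finite C' \<and> C' \<subseteq> C \<and> \<Union>C' = \<Union>B"
  shows "compact_space (topology_generated_by B)"
  using assms by (intro Alexander_subbase[OF topology_generated_by_eq_subbase]) simp

definition basic_open :: "'a gorder \<Rightarrow> 'a \<Rightarrow> 'a set set" where
  "basic_open L a = {P \<in> prime_filters L. a \<in> P}"

lemma topo_spec_obj: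
  "topo (spec_obj L) = topology_generated_by
     (basic_open L ` carrier L \<union> (\<lambda>a. prime_filters L - basic_open L a) ` carrier L)"
proof -
  have "{P \<in> prime_filters L. a \<notin> P} = prime_filters L - basic_open L a" for a
    unfolding basic_open_def by blast
  then show ?thesis unfolding spec_obj_def by (simp add: basic_open_def[abs_def])
qed

lemma ord_spec_obj: "(P, Q) \<in> ord (spec_obj L) \<longleftrightarrow> P \<in> prime_filters L \<and> Q \<in> prime_filters L \<and> P \<subseteq> Q"
  unfolding spec_obj_def by simp

context frame
begin

abbreviation \<phi> :: "'a \<Rightarrow> 'a set set" where
  "\<phi> \<equiv> basic_open L"

lemma \<phi>_iff: "P \<in> \<phi> a \<longleftrightarrow> P \<in> prime_filters L \<and> a \<in> P"
  unfolding basic_open_def by simp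

lemma \<phi>_subset_iff: "\<lbrakk>a \<in> carrier L; b \<in> carrier L\<rbrakk> \<Longrightarrow> \<phi> a \<subseteq> \<phi> b \<longleftrightarrow> a \<sqsubseteq> b"
  unfolding le_iff_prime_filters basic_open_def by blast

lemma \<phi>_meet: "\<lbrakk>a \<in> carrier L; b \<in> carrier L\<rbrakk> \<Longrightarrow> \<phi> (a \<sqinter> b) = \<phi> a \<inter> \<phi> b"
  by (auto simp: \<phi>_iff meet_in_prime_filter_iff)

lemma \<phi>_join: "\<lbrakk>a \<in> carrier L; b \<in> carrier L\<rbrakk> \<Longrightarrow> \<phi> (a \<squnion> b) = \<phi> a \<union> \<phi> b"
  by (auto simp: \<phi>_iff join_in_prime_filter_iff)

lemma \<phi>_top: "\<phi> \<top> = prime_filters L"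
  using prime_filtersD(2) unfolding basic_open_def by blast

lemma \<phi>_bottom: "\<phi> \<bottom> = {}"
  using prime_filtersD(3) unfolding basic_open_def by blast

lemma subbase_Union:
  "\<Union>(\<phi> ` carrier L \<union> (\<lambda>a. prime_filters L - \<phi> a) ` carrier L) = prime_filters L"
proof -
  have "\<phi> \<top> \<in> \<phi> ` carrier L" by (rule imageI) (rule top_closed)
  then have "prime_filters L \<in> \<phi> ` carrier L" unfolding \<phi>_top .
  moreover have "\<phi> a \<subseteq> prime_filters L" for a unfolding basic_open_def by blast
  ultimately show ?thesis by blast
qed

lemma pts_spec_obj: "pts (spec_obj L) = prime_filters L"
  unfolding topo_spec_obj topology_generated_by_topspace by (rule subbase_Union)

lemma clopenin_\<phi>: "a \<in> carrier L \<Longrightarrow> clopenin (topo (spec_obj L)) (\<phi> a)"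
proof -
  assume a: "a \<in> carrier L"
  have "openin (topo (spec_obj L)) (\<phi> a)" "openin (topo (spec_obj L)) (prime_filters L - \<phi> a)"
    unfolding topo_spec_obj by (rule topology_generated_by_Basis, use a in blast)+
  then show ?thesis unfolding clopenin_def closedin_def pts_spec_obj by (auto simp: \<phi>_iff)
qed

lemma \<phi>_ClopUp: "a \<in> carrier L \<Longrightarrow> \<phi> a \<in> ClopUp (spec_obj L)"
  unfolding ClopUp_def upset_def up_def using clopenin_\<phi>
  by (auto simp: pts_spec_obj ord_spec_obj \<phi>_iff)

lemma lattice_filter_generated:
  assumes "N \<subseteq> carrier L"
  shows "lattice_filter {x \<in> carrier L. \<exists>T\<subseteq>N. finite T \<and> \<Sqinter>T \<sqsubseteq> x}" (is "lattice_filter ?F")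
proof (rule lattice_filterI)
  show "x \<sqinter> y \<in> ?F" if xy: "x \<in> ?F" "y \<in> ?F" for x y
  proof -
    obtain S T where ST: "S \<subseteq> N" "finite S" "\<Sqinter>S \<sqsubseteq> x" "T \<subseteq> N" "finite T" "\<Sqinter>T \<sqsubseteq> y"
      using xy by blast
    have c: "x \<in> carrier L" "y \<in> carrier L" "S \<subseteq> carrier L" "T \<subseteq> carrier L"
      using xy ST assms by auto
    have "\<Sqinter>(S \<union> T) \<sqsubseteq> \<Sqinter>S" "\<Sqinter>(S \<union> T) \<sqsubseteq> \<Sqinter>T"
      using c by (auto simp: le_Inf_iff intro: inf_lower)
    then have "\<Sqinter>(S \<union> T) \<sqsubseteq> x" "\<Sqinter>(S \<union> T) \<sqsubseteq> y"
      using c le_trans[OF _ ST(3)] le_trans[OF _ ST(6)] by auto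
    then have "\<Sqinter>(S \<union> T) \<sqsubseteq> x \<sqinter> y" using c by (simp add: le_meet_iff)
    moreover have "S \<union> T \<subseteq> N" "finite (S \<union> T)" using ST by auto
    ultimately show ?thesis using c by (intro CollectI conjI exI[of _ "S \<union> T"] meet_closed)
  qed
  show "y \<in> ?F" if xy: "x \<in> ?F" "y \<in> carrier L" "x \<sqsubseteq> y" for x y
  proof -
    obtain T where T: "T \<subseteq> N" "finite T" "\<Sqinter>T \<sqsubseteq> x" "x \<in> carrier L" using xy by blast
    then have "\<Sqinter>T \<sqsubseteq> y" using assms by (intro le_trans[OF T(3) xy(3)] inf_closed xy(2)) auto
    with T(1,2) xy(2) show ?thesis by (intro CollectI conjI exI[of _ T])
  qed
  show "?F \<subseteq> carrier L" by blast
  show "\<top> \<in> ?F" by (auto intro!: exI[of _ "{}"])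
qed

lemma lattice_ideal_generated:
  assumes "N \<subseteq> carrier L"
  shows "lattice_ideal {x \<in> carrier L. \<exists>T\<subseteq>N. finite T \<and> x \<sqsubseteq> \<Squnion>T}" (is "lattice_ideal ?I")
proof (rule lattice_idealI)
  show "x \<squnion> y \<in> ?I" if xy: "x \<in> ?I" "y \<in> ?I" for x y
  proof -
    obtain S T where ST: "S \<subseteq> N" "finite S" "x \<sqsubseteq> \<Squnion>S" "T \<subseteq> N" "finite T" "y \<sqsubseteq> \<Squnion>T"
      using xy by blast
    have c: "x \<in> carrier L" "y \<in> carrier L" "S \<subseteq> carrier L" "T \<subseteq> carrier L"
      using xy ST assms by auto
    have "\<Squnion>S \<sqsubseteq> \<Squnion>(S \<union> T)" "\<Squnion>T \<sqsubseteq> \<Squnion>(S \<union> T)"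
      using c by (auto simp: Sup_le_iff intro: sup_upper)
    then have "x \<sqsubseteq> \<Squnion>(S \<union> T)" "y \<sqsubseteq> \<Squnion>(S \<union> T)"
      using c le_trans[OF ST(3)] le_trans[OF ST(6)] by auto
    then have "x \<squnion> y \<sqsubseteq> \<Squnion>(S \<union> T)" using c by (simp add: join_le_iff)
    moreover have "S \<union> T \<subseteq> N" "finite (S \<union> T)" using ST by auto
    ultimately show ?thesis using c by (intro CollectI conjI exI[of _ "S \<union> T"] join_closed)
  qed
  show "y \<in> ?I" if xy: "x \<in> ?I" "y \<in> carrier L" "y \<sqsubseteq> x" for x y
  proof -
    obtain T where T: "T \<subseteq> N" "finite T" "x \<sqsubseteq> \<Squnion>T" "x \<in> carrier L" using xy by blast
    then have "y \<sqsubseteq> \<Squnion>T" using assms by (intro le_trans[OF xy(3) T(3)] sup_closed xy(2)) auto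
    with T(1,2) xy(2) show ?thesis by (intro CollectI conjI exI[of _ T])
  qed
  show "?I \<subseteq> carrier L" by blast
  show "\<bottom> \<in> ?I" by (auto intro!: exI[of _ "{}"])
qed

text \<open>
  By Alexander's subbase theorem a cover may be taken to consist of sets \<open>\<phi> a\<close>
  with \<open>a \<in> A\<close> and complements of sets \<open>\<phi> b\<close> with \<open>b
  \<in> N\<close>. A prime filter that contains \<open>N\<close> and avoids \<open>A\<close>
  would be uncovered, so the filter generated by \<open>N\<close> meets the ideal generated by
  \<open>A\<close>; the finitely many elements witnessing this give the finite subcover.
\<close>

lemma compact_spec: "compact_space (topo (spec_obj L))"
  unfolding topo_spec_obj
proof (rule compact_space_generated, unfold subbase_Union)
  fix C assume C: "C \<subseteq> \<phi> ` carrier L \<union> (\<lambda>a. prime_filters L - \<phi> a) ` carrier L"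
    and cover: "\<Union>C = prime_filters L"
  define A where "A = {a \<in> carrier L. \<phi> a \<in> C}"
  define N where "N = {b \<in> carrier L. prime_filters L - \<phi> b \<in> C}"
  have sub: "A \<subseteq> carrier L" "N \<subseteq> carrier L" unfolding A_def N_def by blast+
  define F where "F = {x \<in> carrier L. \<exists>T\<subseteq>N. finite T \<and> \<Sqinter>T \<sqsubseteq> x}"
  define I where "I = {x \<in> carrier L. \<exists>T\<subseteq>A. finite T \<and> x \<sqsubseteq> \<Squnion>T}"
  have F: "lattice_filter F" unfolding F_def by (rule lattice_filter_generated[OF sub(2)])
  have I: "lattice_ideal I" unfolding I_def by (rule lattice_ideal_generated[OF sub(1)])
  have NF: "N \<subseteq> F"
  proof
    fix b assume "b \<in> N"
    then show "b \<in> F" unfolding F_def using sub inf_lower[of "{b}" b] by (auto intro!: exI[of _ "{b}"])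
  qed
  have AI: "A \<subseteq> I"
  proof
    fix a assume "a \<in> A"
    then show "a \<in> I" unfolding I_def using sub sup_upper[of "{a}" a] by (auto intro!: exI[of _ "{a}"])
  qed
  have "F \<inter> I \<noteq> {}"
  proof
    assume "F \<inter> I = {}"
    then obtain P where P: "P \<in> prime_filters L" "F \<subseteq> P" "P \<inter> I = {}"
      by (rule prime_filter_separation[OF F I])
    then obtain U where U: "U \<in> C" "P \<in> U" using cover by blast
    then consider a where "a \<in> carrier L" "U = \<phi> a" | b where "b \<in> carrier L" "U = prime_filters L - \<phi> b"
      using C by blast
    then show False
    proof cases
      case 1
      then have "a \<in> A" "a \<in> P" using U unfolding A_def by (auto simp: \<phi>_iff)
      then show False using AI P(3) by blast
    next
      case 2
      then have "b \<in> N" "b \<notin> P" using U P(1) unfolding N_def by (auto simp: \<phi>_iff)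
      then show False using NF P(2) by blast
    qed
  qed
  then obtain x where x: "x \<in> F" "x \<in> I" by (meson disjoint_iff)
  from x(1)[unfolded F_def] obtain S where "S \<subseteq> N \<and> finite S \<and> \<Sqinter>S \<sqsubseteq> x" unfolding mem_Collect_eq by meson
  moreover from x(2)[unfolded I_def] obtain T where "T \<subseteq> A \<and> finite T \<and> x \<sqsubseteq> \<Squnion>T" unfolding mem_Collect_eq by meson
  ultimately have ST: "x \<in> carrier L" "S \<subseteq> N" "finite S" "\<Sqinter>S \<sqsubseteq> x" "T \<subseteq> A" "finite T" "x \<sqsubseteq> \<Squnion>T"
    using x(1) lattice_filterD(1)[OF F] by auto
  have c: "S \<subseteq> carrier L" "T \<subseteq> carrier L" using ST sub by auto
  have le: "\<Sqinter>S \<sqsubseteq> \<Squnion>T" using le_trans[OF ST(4,7)] ST(1) c by simp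
  let ?C = "\<phi> ` T \<union> (\<lambda>b. prime_filters L - \<phi> b) ` S"
  have "prime_filters L \<subseteq> \<Union>?C"
  proof
    fix P assume P: "P \<in> prime_filters L"
    show "P \<in> \<Union>?C"
    proof (cases "S \<subseteq> P")
      case True
      then have "\<Squnion>T \<in> P"
        using prime_filtersD(4)[OF P Inf_in_prime_filter[OF P ST(3)] _ le] c by simp
      then obtain a where "a \<in> T" "a \<in> P" using Sup_in_prime_filter[OF P ST(6) c(2)] by blast
      then show ?thesis using P by (auto simp: \<phi>_iff)
    next
      case False
      then show ?thesis using P by (auto simp: \<phi>_iff)
    qed
  qed
  moreover have "?C \<subseteq> C" using ST(2,5) unfolding A_def N_def by blast
  moreover have "finite ?C" using ST(3,6) by simp
  ultimately show "\<exists>C'. finite C' \<and> C' \<subseteq> C \<and> \<Union>C' = prime_filters L"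
    using cover by (intro exI[of _ ?C]) blast
qed

lemma priestley_spec: "priestley_space (spec_obj L)"
  unfolding priestley_space_def
proof (intro conjI ballI impI)
  show "compact_space (topo (spec_obj L))" by (rule compact_spec)
  show "partial_order_on (pts (spec_obj L)) (ord (spec_obj L))"
    unfolding partial_order_on_def preorder_on_def refl_on_def trans_def antisym_def pts_spec_obj
    by (auto simp: ord_spec_obj)
  fix P Q assume "P \<in> pts (spec_obj L)" "Q \<in> pts (spec_obj L)" "(P, Q) \<notin> ord (spec_obj L)"
  then obtain a where "P \<in> prime_filters L" "a \<in> P" "a \<notin> Q" by (auto simp: ord_spec_obj pts_spec_obj)
  then show "\<exists>U\<in>ClopUp (spec_obj L). P \<in> U \<and> Q \<notin> U"
    using prime_filtersD(1) by (intro bexI[of _ "\<phi> a"] \<phi>_ClopUp) (auto simp: \<phi>_iff)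
qed

sublocale spec: priestley "spec_obj L"
  by (simp add: priestley_def priestley_spec)

theorem ClopUp_spec: "ClopUp (spec_obj L) = \<phi> ` carrier L"
proof (rule spec.ClopUp_eq_separating_lattice)
  have "U \<inter> V \<in> \<phi> ` carrier L \<and> U \<union> V \<in> \<phi> ` carrier L"
    if "U \<in> \<phi> ` carrier L" "V \<in> \<phi> ` carrier L" for U V
    using that by (auto simp flip: \<phi>_meet \<phi>_join)
  moreover have "\<exists>U\<in>\<phi> ` carrier L. P \<in> U \<and> Q \<notin> U"
    if PQ: "P \<in> pts (spec_obj L)" "Q \<in> pts (spec_obj L)" "(P, Q) \<notin> ord (spec_obj L)" for P Q
  proof -
    obtain a where "P \<in> prime_filters L" "a \<in> P" "a \<notin> Q"
      using PQ by (auto simp: ord_spec_obj pts_spec_obj)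
    moreover from this have "a \<in> carrier L" using prime_filtersD(1) by blast
    ultimately show ?thesis by (intro bexI[of _ "\<phi> a"]) (auto simp: \<phi>_iff)
  qed
  moreover have "{} \<in> \<phi> ` carrier L" "pts (spec_obj L) \<in> \<phi> ` carrier L"
    using imageI[OF bottom_closed, of \<phi>] imageI[OF top_closed, of \<phi>]
    unfolding \<phi>_top \<phi>_bottom pts_spec_obj .
  moreover have "\<phi> ` carrier L \<subseteq> ClopUp (spec_obj L)" by (rule image_subsetI) (rule \<phi>_ClopUp)
  ultimately show "spec.separating_lattice (\<phi> ` carrier L)"
    unfolding spec.separating_lattice_def by (intro conjI ballI impI) presburger+
qed

text \<open>
  Heyting implication, the relative pseudocomplement of \<open>a\<close> with respect to
  \<open>b\<close>.
\<close>

definition implication :: "'a \<Rightarrow> 'a \<Rightarrow> 'a" where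
  "implication a b = \<Squnion>{x \<in> carrier L. a \<sqinter> x \<sqsubseteq> b}"

lemma implication_closed [simp]: "implication a b \<in> carrier L"
  unfolding implication_def by (rule sup_closed) blast

lemma le_implicationI: "\<lbrakk>x \<in> carrier L; a \<sqinter> x \<sqsubseteq> b\<rbrakk> \<Longrightarrow> x \<sqsubseteq> implication a b"
  unfolding implication_def by (rule sup_upper) auto

lemma meet_implication_le: "\<lbrakk>a \<in> carrier L; b \<in> carrier L\<rbrakk> \<Longrightarrow> a \<sqinter> implication a b \<sqsubseteq> b"
  unfolding implication_def by (rule meet_Sup_le) auto

text \<open>
  A prime filter \<open>Q\<close> extends to one that contains \<open>a\<close> but not
  \<open>b\<close> iff adjoining \<open>a\<close> to \<open>Q\<close> does not generate
  \<open>b\<close>, that is, iff no \<open>q \<in> Q\<close> has \<open>q \<sqinter> a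
  \<sqsubseteq> b\<close>.
\<close>

lemma down_\<phi>_diff:
  assumes ab: "a \<in> carrier L" "b \<in> carrier L"
  shows "down (spec_obj L) (\<phi> a - \<phi> b) = prime_filters L - \<phi> (implication a b)"
proof (intro subset_antisym subsetI)
  fix Q assume "Q \<in> down (spec_obj L) (\<phi> a - \<phi> b)"
  then obtain P where P: "P \<in> prime_filters L" "a \<in> P" "b \<notin> P" "Q \<in> prime_filters L" "Q \<subseteq> P"
    unfolding down_def by (auto simp: \<phi>_iff ord_spec_obj)
  have "implication a b \<notin> P"
    using prime_filtersD(4)[OF P(1) prime_filtersD(5)[OF P(1,2)] ab(2) meet_implication_le[OF ab]] P(3)
    by blast
  then show "Q \<in> prime_filters L - \<phi> (implication a b)" using P by (auto simp: \<phi>_iff)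
next
  fix Q assume "Q \<in> prime_filters L - \<phi> (implication a b)"
  then have Q: "Q \<in> prime_filters L" "implication a b \<notin> Q" by (auto simp: \<phi>_iff)
  note Qf = lattice_filter_prime[OF Q(1)]
  let ?G = "{x \<in> carrier L. \<exists>q\<in>Q. q \<sqinter> a \<sqsubseteq> x}"
  have "?G \<inter> {x \<in> carrier L. x \<sqsubseteq> b} = {}"
  proof (rule ccontr)
    assume "\<not> ?thesis"
    then obtain x where "x \<in> ?G" and x1: "x \<in> carrier L" "x \<sqsubseteq> b" by (auto simp: disjoint_iff)
    then obtain q where x2: "q \<in> Q" "q \<sqinter> a \<sqsubseteq> x" by (elim CollectE conjE bexE)
    note x = x1 x2
    then have q: "q \<in> carrier L" using prime_filtersD(1)[OF Q(1)] by blast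
    then have "a \<sqinter> q \<sqsubseteq> b" using le_trans[OF x(4,2)] x(1) ab by (simp add: meet_comm[of L a q])
    then have "implication a b \<in> Q"
      using prime_filtersD(4)[OF Q(1) x(3)] le_implicationI[OF q] by simp
    then show False using Q(2) by blast
  qed
  then obtain P where P: "P \<in> prime_filters L" "?G \<subseteq> P" "P \<inter> {x \<in> carrier L. x \<sqsubseteq> b} = {}"
    by (rule prime_filter_separation[OF lattice_filter_adjoin(1)[OF Qf ab(1)] lattice_ideal_principal[OF ab(2)]])
  have "Q \<subseteq> P" "a \<in> P" using lattice_filter_adjoin(2,3)[OF Qf ab(1)] P(2) by blast+
  moreover have "b \<notin> P" using P(3) ab(2) by auto
  ultimately show "Q \<in> down (spec_obj L) (\<phi> a - \<phi> b)"
    unfolding down_def pts_spec_obj using P(1) Q(1) by (auto simp: \<phi>_iff ord_spec_obj)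
qed

sublocale spec: esakia "spec_obj L"
proof
  fix C assume "clopenin (topo (spec_obj L)) C"
  then show "clopenin (topo (spec_obj L)) (down (spec_obj L) C)"
  proof (induction C rule: spec.clopen_induct)
    case empty
    show ?case by (simp add: down_def)
  next
    case (Un A B)
    then show ?case by (simp add: spec.down_Un)
  next
    case (basic V W)
    then obtain a b where "a \<in> carrier L" "V = \<phi> a" "b \<in> carrier L" "W = \<phi> b"
      unfolding ClopUp_spec by blast
    then show ?case
      using clopenin_simps(2)[of "topo (spec_obj L)"]
      by (simp add: down_\<phi>_diff clopenin_\<phi> pts_spec_obj)
  qed
qed

text \<open>
  A basic open set \<open>\<phi> v - \<phi> w\<close> disjoint from all \<open>\<phi> a\<close>
  satisfies \<open>v \<sqinter> a \<sqsubseteq> w\<close> for all \<open>a \<in> A\<close>, so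
  by the frame law \<open>v \<sqinter> \<Squnion>A \<sqsubseteq> w\<close>, and it is disjoint
  from \<open>\<phi> (\<Squnion>A)\<close>.
\<close>

lemma closure_Union_\<phi>:
  assumes A: "A \<subseteq> carrier L"
  shows "topo (spec_obj L) closure_of (\<Union>(\<phi> ` A)) = \<phi> (\<Squnion>A)"
proof
  have c: "\<Squnion>A \<in> carrier L" using A by simp
  show "topo (spec_obj L) closure_of (\<Union>(\<phi> ` A)) \<subseteq> \<phi> (\<Squnion>A)"
  proof (rule closure_of_minimal)
    show "\<Union>(\<phi> ` A) \<subseteq> \<phi> (\<Squnion>A)"
      using A c sup_upper[OF A] \<phi>_subset_iff by blast
    show "closedin (topo (spec_obj L)) (\<phi> (\<Squnion>A))" using clopenin_\<phi>[OF c] by (simp add: clopenin_def)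
  qed
  show "\<phi> (\<Squnion>A) \<subseteq> topo (spec_obj L) closure_of (\<Union>(\<phi> ` A))" (is "_ \<subseteq> ?cl")
  proof (rule ccontr)
    assume "\<not> ?thesis"
    then obtain P where "P \<in> \<phi> (\<Squnion>A)" "P \<notin> ?cl" by blast
    then have P: "P \<in> prime_filters L" "\<Squnion>A \<in> P" "P \<notin> ?cl" by (simp_all add: \<phi>_iff)
    have "openin (topo (spec_obj L)) (pts (spec_obj L) - ?cl)" by (simp add: openin_diff)
    moreover have "P \<in> pts (spec_obj L) - ?cl" using P by (simp add: pts_spec_obj)
    ultimately obtain V W where VW: "V \<in> ClopUp (spec_obj L)" "W \<in> ClopUp (spec_obj L)"
      "P \<in> V - W" "V - W \<subseteq> pts (spec_obj L) - ?cl"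
      using spec.basic_neighbourhood by meson
    then obtain v w where vw: "v \<in> carrier L" "V = \<phi> v" "w \<in> carrier L" "W = \<phi> w"
      unfolding ClopUp_spec by blast
    have sub: "\<Union>(\<phi> ` A) \<subseteq> ?cl"
      by (intro closure_of_subset) (auto simp: pts_spec_obj \<phi>_iff)
    have "v \<sqinter> a \<sqsubseteq> w" if a: "a \<in> A" for a
    proof -
      have "\<phi> v \<inter> \<phi> a \<subseteq> \<phi> w" using VW(4) sub a unfolding vw(2,4) by blast
      then show ?thesis using a A vw(1,3) by (simp flip: \<phi>_subset_iff add: \<phi>_meet subset_iff)
    qed
    then have "v \<sqinter> \<Squnion>A \<sqsubseteq> w" by (intro meet_Sup_le vw A)
    moreover have "v \<sqinter> \<Squnion>A \<in> P" using VW(3) P(2) prime_filtersD(5)[OF P(1)] vw(2) by (auto simp: \<phi>_iff)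
    ultimately have "w \<in> P" using prime_filtersD(4)[OF P(1)] vw(3) by blast
    then show False using VW(3) P(1) vw(4) by (auto simp: \<phi>_iff)
  qed
qed

lemma open_upset_spec:
  assumes "openin (topo (spec_obj L)) U" "upset (spec_obj L) U"
  obtains A where "A \<subseteq> carrier L" "U = \<Union>(\<phi> ` A)"
proof -
  have "U = \<Union>(\<phi> ` {a \<in> carrier L. \<phi> a \<subseteq> U})"
    using spec.open_upset_eq_Union[OF assms] unfolding ClopUp_spec by blast
  then show thesis using that[of "{a \<in> carrier L. \<phi> a \<subseteq> U}"] by blast
qed

sublocale spec: Lspace "spec_obj L"
proof
  fix U assume "openin (topo (spec_obj L)) U" "upset (spec_obj L) U"
  then obtain A where A: "A \<subseteq> carrier L" "U = \<Union>(\<phi> ` A)" by (rule open_upset_spec)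
  then show "openin (topo (spec_obj L)) (topo (spec_obj L) closure_of U)"
    using clopenin_\<phi>[of "\<Squnion>A"] by (simp add: closure_Union_\<phi> clopenin_def)
qed

theorem order_iso_\<phi>: "order_iso L (clop_obj (spec_obj L)) (\<lambda>a\<in>carrier L. \<phi> a)"
proof -
  have "a = b" if "a \<in> carrier L" "b \<in> carrier L" "\<phi> a = \<phi> b" for a b
    using that \<phi>_subset_iff[of a b] \<phi>_subset_iff[of b a] le_antisym by blast
  then have "bij_betw \<phi> (carrier L) (ClopUp (spec_obj L))"
    unfolding bij_betw_def inj_on_def ClopUp_spec by blast
  then have "bij_betw (\<lambda>a\<in>carrier L. \<phi> a) (carrier L) (ClopUp (spec_obj L))"
    by (simp cong: bij_betw_cong)
  then show ?thesis
    unfolding order_iso_def by (auto simp: \<phi>_ClopUp \<phi>_subset_iff simp del: subset_iff)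
qed

lemma iso_\<phi>: "complete_lattice_iso L (clop_obj (spec_obj L)) (\<lambda>a\<in>carrier L. \<phi> a)"
  by (intro complete_lattice_iso.intro complete_lattice_iso_axioms.intro order_iso_\<phi>)
    (rule complete_lattice_axioms spec.complete_lattice_clop_obj)+

text \<open>
  Compactness and regularity pass from \<open>L\<close> along \<open>\<phi>\<close> to the frame
  of clopen upsets, where they amount to L-compactness and L-regularity of the space.
\<close>

theorem KRL_space_spec:
  assumes "compact_frame L" "regular_frame L"
  shows "KRL_space (spec_obj L)"
proof -
  interpret iso: complete_lattice_iso L "clop_obj (spec_obj L)" "\<lambda>a\<in>carrier L. \<phi> a"
    by (rule iso_\<phi>)
  have "L_space (spec_obj L)" using spec.Lspace_axioms by (simp add: Lspace_iff)
  then show ?thesis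
    using iso.compact_frame_transfer iso.regular_frame_transfer assms
    unfolding KRL_space_def spec.compact_clop_obj_iff spec.regular_clop_obj_iff by simp
qed

end

section \<open>Frame homomorphisms and L-morphisms\<close>

locale frame_hom = L: frame L + M: frame M for L :: "'a gorder" and M :: "'b gorder" +
  fixes h :: "'a \<Rightarrow> 'b"
  assumes hom: "h \<in> frame_homs L M"
begin

lemma h_PiE: "h \<in> carrier L \<rightarrow>\<^sub>E carrier M"
  using hom unfolding frame_homs_def by blast

lemma h_closed [simp]: "a \<in> carrier L \<Longrightarrow> h a \<in> carrier M"
  using h_PiE by auto

lemma h_top: "h \<top>\<^bsub>L\<^esub> = \<top>\<^bsub>M\<^esub>"
  using hom unfolding frame_homs_def by blast

lemma h_meet: "\<lbrakk>a \<in> carrier L; b \<in> carrier L\<rbrakk> \<Longrightarrow> h (a \<sqinter>\<^bsub>L\<^esub> b) = h a \<sqinter>\<^bsub>M\<^esub> h b"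
  using hom unfolding frame_homs_def by blast

lemma h_Sup: "S \<subseteq> carrier L \<Longrightarrow> h (\<Squnion>\<^bsub>L\<^esub> S) = \<Squnion>\<^bsub>M\<^esub> (h ` S)"
  using hom unfolding frame_homs_def by blast

lemma h_join: "\<lbrakk>a \<in> carrier L; b \<in> carrier L\<rbrakk> \<Longrightarrow> h (a \<squnion>\<^bsub>L\<^esub> b) = h a \<squnion>\<^bsub>M\<^esub> h b"
  unfolding join_def by (simp add: h_Sup)

lemma h_bottom: "h \<bottom>\<^bsub>L\<^esub> = \<bottom>\<^bsub>M\<^esub>"
proof -
  have "\<bottom>\<^bsub>L\<^esub> = \<Squnion>\<^bsub>L\<^esub> {}" by (rule L.bottomI) (auto simp: L.Sup_le_iff)
  moreover have "\<bottom>\<^bsub>M\<^esub> = \<Squnion>\<^bsub>M\<^esub> {}" by (rule M.bottomI) (auto simp: M.Sup_le_iff)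
  ultimately show ?thesis using h_Sup[of "{}"] by simp
qed

lemma h_mono:
  assumes "a \<in> carrier L" "b \<in> carrier L" "a \<sqsubseteq>\<^bsub>L\<^esub> b"
  shows "h a \<sqsubseteq>\<^bsub>M\<^esub> h b"
  using assms h_meet[of a b] by (simp add: L.le_iff_join M.le_iff_join)

lemma preimage_prime_filter:
  assumes P: "P \<in> prime_filters M"
  shows "{a \<in> carrier L. h a \<in> P} \<in> prime_filters L"
proof -
  note P' = prime_filtersD[OF P]
  show ?thesis
    unfolding prime_filters_def mem_Collect_eq
  proof (intro conjI ballI impI)
    show "b \<in> carrier L" "h b \<in> P"
      if "a \<in> {a \<in> carrier L. h a \<in> P}" "b \<in> carrier L" "a \<sqsubseteq>\<^bsub>L\<^esub> b" for a b
      using that P'(4)[of "h a" "h b"] h_mono[of a b] by auto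
  qed (use P'(2,3) M.join_in_prime_filter_iff[OF P] M.meet_in_prime_filter_iff[OF P] in
      \<open>auto simp: h_top h_bottom h_join h_meet\<close>)
qed

lemma spec_mor_closed: "P \<in> prime_filters M \<Longrightarrow> spec_mor L M h P \<in> prime_filters L"
  unfolding spec_mor_def by (simp add: preimage_prime_filter)

lemma spec_mor_basic_open:
  assumes "a \<in> carrier L"
  shows "{P \<in> prime_filters M. spec_mor L M h P \<in> basic_open L a} = basic_open M (h a)"
  using assms preimage_prime_filter by (auto simp: spec_mor_def basic_open_def)

text \<open>
  Taking preimages turns \<open>\<phi> a\<close> into \<open>\<phi> (h a)\<close>. The condition
  on closures is then the preservation of joins by \<open>h\<close>, since open upsets are
  unions of sets \<open>\<phi> a\<close>.
\<close>

theorem spec_mor_L_morphism: "spec_mor L M h \<in> L_morphisms (spec_obj M) (spec_obj L)"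
proof -
  let ?s = "spec_mor L M h"
  have "continuous_map (topo (spec_obj M)) (topo (spec_obj L)) ?s"
    unfolding topo_spec_obj[of L]
  proof (rule continuous_on_generated_topo, unfold L.subbase_Union)
    show "?s ` pts (spec_obj M) \<subseteq> prime_filters L"
      using spec_mor_closed by (auto simp: M.pts_spec_obj)
    fix U assume "U \<in> basic_open L ` carrier L \<union> (\<lambda>a. prime_filters L - basic_open L a) ` carrier L"
    then obtain a where a: "a \<in> carrier L" and U: "U = basic_open L a \<or> U = prime_filters L - basic_open L a"
      by blast
    have eq: "?s -` basic_open L a \<inter> prime_filters M = basic_open M (h a)"
      using spec_mor_basic_open[OF a] by auto
    have "?s -` (prime_filters L - basic_open L a) \<inter> prime_filters M = prime_filters M - basic_open M (h a)"
      using eq spec_mor_closed by auto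
    moreover have "clopenin (topo (spec_obj M)) (basic_open M (h a))" using a by (simp add: M.clopenin_\<phi>)
    ultimately show "openin (topo (spec_obj M)) (?s -` U \<inter> pts (spec_obj M))"
      using U eq unfolding clopenin_def closedin_def M.pts_spec_obj by auto
  qed
  moreover have "{P \<in> pts (spec_obj M). ?s P \<in> topo (spec_obj L) closure_of U} =
      topo (spec_obj M) closure_of {P \<in> pts (spec_obj M). ?s P \<in> U}"
    if U: "openin (topo (spec_obj L)) U" "upset (spec_obj L) U" for U
  proof -
    obtain A where A: "A \<subseteq> carrier L" "U = \<Union>(basic_open L ` A)" using U by (rule L.open_upset_spec)
    have "{P \<in> pts (spec_obj M). ?s P \<in> topo (spec_obj L) closure_of U} = basic_open M (h (\<Squnion>\<^bsub>L\<^esub> A))"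
      unfolding A(2) L.closure_Union_\<phi>[OF A(1)] M.pts_spec_obj
      using A(1) by (intro spec_mor_basic_open) simp
    also have "\<dots> = topo (spec_obj M) closure_of (\<Union>(basic_open M ` h ` A))"
      unfolding h_Sup[OF A(1)] using A(1) by (intro M.closure_Union_\<phi>[symmetric]) auto
    also have "(\<Union>(basic_open M ` h ` A)) = (\<Union>a\<in>A. {P \<in> prime_filters M. ?s P \<in> basic_open L a})"
      using A(1) spec_mor_basic_open by (auto simp: subset_iff)
    also have "\<dots> = {P \<in> pts (spec_obj M). ?s P \<in> U}"
      unfolding A(2) M.pts_spec_obj by blast
    finally show ?thesis .
  qed
  moreover have "?s \<in> pts (spec_obj M) \<rightarrow>\<^sub>E pts (spec_obj L)"
    unfolding M.pts_spec_obj L.pts_spec_obj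
    using spec_mor_closed by (auto simp: spec_mor_def)
  moreover have "(?s P, ?s Q) \<in> ord (spec_obj L)" if "(P, Q) \<in> ord (spec_obj M)" for P Q
    using that spec_mor_closed by (auto simp: ord_spec_obj) (auto simp: spec_mor_def)
  ultimately show ?thesis unfolding L_morphisms_def by blast
qed

end

lemma L_morphismsD:
  assumes "f \<in> L_morphisms X Y"
  shows "f \<in> pts X \<rightarrow>\<^sub>E pts Y" "\<And>x. x \<in> pts X \<Longrightarrow> f x \<in> pts Y"
    "continuous_map (topo X) (topo Y) f"
    "\<And>x y. (x, y) \<in> ord X \<Longrightarrow> (f x, f y) \<in> ord Y"
    "\<And>U. \<lbrakk>openin (topo Y) U; upset Y U\<rbrakk> \<Longrightarrow>
      {x \<in> pts X. f x \<in> topo Y closure_of U} = topo X closure_of {x \<in> pts X. f x \<in> U}"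
  using assms unfolding L_morphisms_def by auto

locale L_morphism = X: Lspace X + Y: Lspace Y for X :: "'a ordered_space" and Y :: "'b ordered_space" +
  fixes f :: "'a \<Rightarrow> 'b"
  assumes mor: "f \<in> L_morphisms X Y"
begin

lemmas props = L_morphismsD[OF mor]

lemma preimage_upset: "upset Y U \<Longrightarrow> upset X {x \<in> pts X. f x \<in> U}"
  unfolding X.upset_iff Y.upset_iff using props(4) X.ord_subset by blast

lemma preimage_open: "openin (topo Y) U \<Longrightarrow> openin (topo X) {x \<in> pts X. f x \<in> U}"
  using props(3) by (rule openin_continuous_map_preimage)

lemma preimage_ClopUp:
  assumes "U \<in> ClopUp Y"
  shows "{x \<in> pts X. f x \<in> U} \<in> ClopUp X"
  using assms preimage_upset preimage_open closedin_continuous_map_preimage[OF props(3)]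
  unfolding ClopUp_def clopenin_def by blast

theorem clop_mor_frame_hom: "clop_mor X Y f \<in> frame_homs (clop_obj Y) (clop_obj X)"
proof -
  let ?c = "clop_mor X Y f"
  have c: "?c U = {x \<in> pts X. f x \<in> U}" if "U \<in> ClopUp Y" for U
    using that unfolding clop_mor_def by simp
  have "?c (\<Squnion>\<^bsub>clop_obj Y\<^esub> S) = \<Squnion>\<^bsub>clop_obj X\<^esub> (?c ` S)" if S: "S \<subseteq> ClopUp Y" for S
  proof -
    have "?c (\<Squnion>\<^bsub>clop_obj Y\<^esub> S) = {x \<in> pts X. f x \<in> topo Y closure_of (\<Union>S)}"
      using c[OF Y.closure_Union_ClopUp[OF S]] by (simp add: Y.Sup_clop_obj[OF S])
    also have "\<dots> = topo X closure_of {x \<in> pts X. f x \<in> \<Union>S}"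
      by (intro props(5) Y.Union_ClopUp S)
    also have "{x \<in> pts X. f x \<in> \<Union>S} = \<Union>(?c ` S)"
      using c S by blast
    also have "topo X closure_of \<dots> = \<Squnion>\<^bsub>clop_obj X\<^esub> (?c ` S)"
      using c preimage_ClopUp S by (intro X.Sup_clop_obj[symmetric]) auto
    finally show ?thesis .
  qed
  moreover have "?c \<in> ClopUp Y \<rightarrow>\<^sub>E ClopUp X"
    using c preimage_ClopUp by (auto simp: clop_mor_def)
  moreover have "?c \<top>\<^bsub>clop_obj Y\<^esub> = \<top>\<^bsub>clop_obj X\<^esub>"
    using props(2) by (auto simp: X.top_clop_obj Y.top_clop_obj c)
  moreover have "?c (U \<sqinter>\<^bsub>clop_obj Y\<^esub> V) = ?c U \<sqinter>\<^bsub>clop_obj X\<^esub> ?c V" if "U \<in> ClopUp Y" "V \<in> ClopUp Y" for U V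
    using that preimage_ClopUp by (auto simp: X.meet_clop_obj Y.meet_clop_obj c)
  ultimately show ?thesis unfolding frame_homs_def by simp
qed

end

section \<open>Points of an L-space as prime filters of clopen upsets\<close>

definition point_filter :: "'a ordered_space \<Rightarrow> 'a \<Rightarrow> 'a set set" where
  "point_filter X = (\<lambda>x\<in>pts X. {U \<in> ClopUp X. x \<in> U})"

text \<open>
  Homeomorphisms commute with closures, so for them the condition on closures is automatic.
\<close>

lemma homeomorphism_L_morphism:
  assumes X: "Lspace X" and Y: "Lspace Y" and hom: "homeomorphic_map (topo X) (topo Y) f"
    and ext: "f \<in> extensional (pts X)"
    and ord: "\<And>x y. \<lbrakk>x \<in> pts X; y \<in> pts X\<rbrakk> \<Longrightarrow> (f x, f y) \<in> ord Y \<longleftrightarrow> (x, y) \<in> ord X"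
  shows "f \<in> L_morphisms X Y"
proof -
  interpret X: Lspace X by (rule X)
  interpret Y: Lspace Y by (rule Y)
  have img: "f ` pts X = pts Y" by (rule homeomorphic_imp_surjective_map[OF hom])
  have inj: "inj_on f (pts X)" by (rule homeomorphic_imp_injective_map[OF hom])
  have "{x \<in> pts X. f x \<in> topo Y closure_of U} = topo X closure_of {x \<in> pts X. f x \<in> U}"
    if U: "upset Y U" for U
  proof -
    have sub: "{x \<in> pts X. f x \<in> U} \<subseteq> pts X" by blast
    have "U \<subseteq> pts Y" using U unfolding upset_def by (rule conjunct1)
    then have "U \<subseteq> f ` pts X" unfolding img .
    then have "f ` {x \<in> pts X. f x \<in> U} = U" by auto
    then have eq: "topo Y closure_of U = f ` (topo X closure_of {x \<in> pts X. f x \<in> U})"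
      using homeomorphic_map_closure_of[OF hom sub] by simp
    have cl: "topo X closure_of {x \<in> pts X. f x \<in> U} \<subseteq> pts X" by (rule closure_of_subset_topspace)
    then have "f x \<in> topo Y closure_of U \<longleftrightarrow> x \<in> topo X closure_of {x \<in> pts X. f x \<in> U}"
      if "x \<in> pts X" for x
      unfolding eq using that by (rule inj_on_image_mem_iff[OF inj, rotated])
    then show ?thesis using cl by blast
  qed
  moreover have "f \<in> pts X \<rightarrow>\<^sub>E pts Y" using img ext by (auto simp: PiE_def)
  moreover have "(f x, f y) \<in> ord Y" if "(x, y) \<in> ord X" for x y
    using that ord X.ord_subset by blast
  ultimately show ?thesis
    unfolding L_morphisms_def using homeomorphic_imp_continuous_map[OF hom] by blast
qed

lemma L_iso_of_homeomorphism:
  assumes X: "Lspace X" and Y: "Lspace Y" and hom: "homeomorphic_map (topo X) (topo Y) f"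
    and ext: "f \<in> extensional (pts X)"
    and ord: "\<And>x y. \<lbrakk>x \<in> pts X; y \<in> pts X\<rbrakk> \<Longrightarrow> (f x, f y) \<in> ord Y \<longleftrightarrow> (x, y) \<in> ord X"
  shows "L_iso X Y f"
proof -
  obtain g' where g': "homeomorphic_maps (topo X) (topo Y) f g'"
    using hom unfolding homeomorphic_map_maps by blast
  define g where "g = restrict g' (pts Y)"
  have "homeomorphic_map (topo Y) (topo X) g'" using g' unfolding homeomorphic_maps_map by blast
  then have g_hom: "homeomorphic_map (topo Y) (topo X) g"
    by (rule homeomorphic_map_eq) (simp add: g_def)
  have gf: "\<And>x. x \<in> pts X \<Longrightarrow> g (f x) = x" and fg: "\<And>y. y \<in> pts Y \<Longrightarrow> f (g y) = y"
    and fX: "\<And>x. x \<in> pts X \<Longrightarrow> f x \<in> pts Y" and gY: "\<And>y. y \<in> pts Y \<Longrightarrow> g y \<in> pts X"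
    using g' homeomorphic_imp_surjective_map[OF hom] homeomorphic_imp_surjective_map[OF g_hom]
    unfolding homeomorphic_maps_map g_def by auto
  have "f \<in> L_morphisms X Y" by (rule homeomorphism_L_morphism[OF X Y hom ext ord])
  moreover have "g \<in> L_morphisms Y X"
  proof (rule homeomorphism_L_morphism[OF Y X g_hom])
    show "g \<in> extensional (pts Y)" by (simp add: g_def)
    show "(g x, g y) \<in> ord X \<longleftrightarrow> (x, y) \<in> ord Y" if "x \<in> pts Y" "y \<in> pts Y" for x y
      using ord[OF gY gY, OF that] fg that by simp
  qed
  moreover have "compose (pts X) g f = (\<lambda>x\<in>pts X. x)" "compose (pts Y) f g = (\<lambda>y\<in>pts Y. y)"
    using gf fg by (auto simp: compose_def)
  ultimately show ?thesis unfolding L_iso_def by blast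
qed

context Lspace
begin

interpretation clop_frame: frame "clop_obj X"
  by (rule frame_clop_obj)

lemma point_filter_prime:
  assumes "x \<in> pts X"
  shows "point_filter X x \<in> prime_filters (clop_obj X)"
  using assms unfolding point_filter_def prime_filters_def by (auto simp: clop_obj_ops)

lemma point_filter_subset_iff:
  assumes "x \<in> pts X" "y \<in> pts X"
  shows "point_filter X x \<subseteq> point_filter X y \<longleftrightarrow> (x, y) \<in> ord X"
proof
  show "(x, y) \<in> ord X" if "point_filter X x \<subseteq> point_filter X y"
    using that separation[OF assms] assms unfolding point_filter_def by auto
  show "point_filter X x \<subseteq> point_filter X y" if "(x, y) \<in> ord X"
    using assms ClopUpD(6)[OF _ _ that] unfolding point_filter_def by auto
qed

text \<open>
  The differences of a member and a non-member of \<open>P\<close> are closed under intersection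
  because \<open>P\<close> is prime, and nonempty because \<open>P\<close> is an upset; a point
  common to all of them lies in exactly the members of \<open>P\<close>.
\<close>

lemma point_filter_surj:
  assumes P: "P \<in> prime_filters (clop_obj X)"
  obtains x where "x \<in> pts X" "point_filter X x = P"
proof -
  note P' = prime_filtersD[OF P, unfolded clop_obj_simps top_clop_obj bottom_clop_obj]
  have meet: "U \<inter> V \<in> P" if "U \<in> P" "V \<in> P" for U V
    using P'(5)[OF that] that P'(1) by (simp add: meet_clop_obj subset_iff)
  have join: "U \<union> V \<notin> P" if "U \<in> ClopUp X - P" "V \<in> ClopUp X - P" for U V
    using P'(6)[of U V] that by (auto simp: join_clop_obj)
  define \<C> where "\<C> = {U - V | U V. U \<in> P \<and> V \<in> ClopUp X - P}"
  have I: "U - V \<in> \<C>" if "U \<in> P" "V \<in> ClopUp X - P" for U V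
    using that unfolding \<C>_def by blast
  have E: "\<exists>U V. C = U - V \<and> U \<in> P \<and> V \<in> ClopUp X - P" if "C \<in> \<C>" for C
    using that unfolding \<C>_def by blast
  have "\<Inter>\<C> \<noteq> {}"
  proof (rule compact_space_directed_Inter[OF compact])
    show "\<C> \<noteq> {}" using I[of "pts X" "{}"] P'(2,3) by auto
    show "closedin (topo X) C" if "C \<in> \<C>" for C
    proof -
      obtain U V where "C = U - V" "U \<in> P" "V \<in> ClopUp X - P" using E[OF \<open>C \<in> \<C>\<close>] by blast
      moreover from this have "U \<in> ClopUp X" "V \<in> ClopUp X" using P'(1) by auto
      ultimately show ?thesis by (simp add: closedin_diff ClopUpD(2,3))
    qed
    show "{} \<notin> \<C>"
    proof
      assume "{} \<in> \<C>"
      then obtain U V where UV: "{} = U - V" "U \<in> P" "V \<in> ClopUp X - P" using E by blast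
      then have "U \<subseteq> V" by blast
      then show False using P'(4)[OF UV(2), of V] UV(3) by blast
    qed
    show "\<exists>D\<in>\<C>. D \<subseteq> A \<inter> B" if "A \<in> \<C>" "B \<in> \<C>" for A B
    proof -
      obtain U V U' V' where UV: "A = U - V" "U \<in> P" "V \<in> ClopUp X - P"
        "B = U' - V'" "U' \<in> P" "V' \<in> ClopUp X - P"
        using E[OF \<open>A \<in> \<C>\<close>] E[OF \<open>B \<in> \<C>\<close>] by blast
      then have "(U \<inter> U') - (V \<union> V') \<in> \<C>"
        using meet join[of V V'] by (intro I) auto
      then show ?thesis using UV by (intro bexI[of _ "(U \<inter> U') - (V \<union> V')"]) auto
    qed
  qed
  then obtain x where x: "x \<in> \<Inter>\<C>" by blast
  have in_P: "x \<in> U" if "U \<in> P" for U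
    using I[OF that, of "{}"] P'(3) x by auto
  have not_P: "x \<notin> V" if "V \<in> ClopUp X" "V \<notin> P" for V
    using I[OF P'(2), of V] that x by auto
  have "x \<in> pts X" using in_P[OF P'(2)] .
  moreover from this have "point_filter X x = P"
    unfolding point_filter_def using in_P not_P P'(1) by auto
  ultimately show thesis by (rule that)
qed

lemma point_filter_image: "point_filter X ` pts X = prime_filters (clop_obj X)"
  using point_filter_prime point_filter_surj by (metis (no_types, lifting) image_iff subsetI subset_antisym)

lemma point_filter_inj: "inj_on (point_filter X) (pts X)"
proof (rule inj_onI)
  fix x y assume "x \<in> pts X" "y \<in> pts X" "point_filter X x = point_filter X y"
  then show "x = y"
    using point_filter_subset_iff[of x y] point_filter_subset_iff[of y x] ord_antisym by simp
qed

lemma point_filter_basic_open: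
  assumes "U \<in> ClopUp X"
  shows "point_filter X -` basic_open (clop_obj X) U \<inter> pts X = U"
  using assms point_filter_prime ClopUpD(5)[OF assms]
  by (auto simp: basic_open_def) (auto simp: point_filter_def)

lemma point_filter_homeomorphism:
  "homeomorphic_map (topo X) (topo (spec_obj (clop_obj X))) (point_filter X)"
proof (rule bijective_open_imp_homeomorphic_map)
  let ?Z = "spec_obj (clop_obj X)"
  show img: "point_filter X ` pts X = pts ?Z"
    unfolding clop_frame.pts_spec_obj by (rule point_filter_image)
  show "inj_on (point_filter X) (pts X)" by (rule point_filter_inj)
  show "continuous_map (topo X) (topo ?Z) (point_filter X)"
    unfolding topo_spec_obj
  proof (rule continuous_on_generated_topo, unfold clop_frame.subbase_Union)
    show "point_filter X ` pts X \<subseteq> prime_filters (clop_obj X)" using point_filter_image by simp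
    fix G assume "G \<in> basic_open (clop_obj X) ` carrier (clop_obj X) \<union>
      (\<lambda>U. prime_filters (clop_obj X) - basic_open (clop_obj X) U) ` carrier (clop_obj X)"
    then obtain U where U: "U \<in> ClopUp X" and
      G: "G = basic_open (clop_obj X) U \<or> G = prime_filters (clop_obj X) - basic_open (clop_obj X) U"
      by auto
    have "point_filter X -` (prime_filters (clop_obj X) - basic_open (clop_obj X) U) \<inter> pts X =
        pts X - (point_filter X -` basic_open (clop_obj X) U \<inter> pts X)"
      using point_filter_prime by blast
    then have "point_filter X -` G \<inter> pts X = U \<or> point_filter X -` G \<inter> pts X = pts X - U"
      using G unfolding point_filter_basic_open[OF U] by (metis point_filter_basic_open[OF U])
    then show "openin (topo X) (point_filter X -` G \<inter> pts X)"
      using ClopUpD(2,3)[OF U] by (auto simp: openin_diff)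
  qed
  show "open_map (topo X) (topo ?Z) (point_filter X)"
    unfolding open_map_def
  proof (intro allI impI)
    fix G assume G: "openin (topo X) G"
    have "\<exists>T. openin (topo ?Z) T \<and> p \<in> T \<and> T \<subseteq> point_filter X ` G" if p: "p \<in> point_filter X ` G" for p
    proof -
      obtain x where x: "x \<in> G" "p = point_filter X x" using p by blast
      obtain V W where VW: "V \<in> ClopUp X" "W \<in> ClopUp X" "x \<in> V - W" "V - W \<subseteq> G"
        using basic_neighbourhood[OF G x(1)] by blast
      have xp: "x \<in> pts X" using openin_subset[OF G] x(1) by blast
      let ?T = "basic_open (clop_obj X) V - basic_open (clop_obj X) W"
      have "openin (topo ?Z) ?T"
        using clop_frame.clopenin_\<phi>[of V] clop_frame.clopenin_\<phi>[of W] VW(1,2)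
        by (simp add: clopenin_def openin_diff)
      moreover have "p \<in> ?T"
        using VW point_filter_basic_open[OF VW(1)] point_filter_basic_open[OF VW(2)] x(2) xp by blast
      moreover have "?T \<subseteq> point_filter X ` G"
      proof
        fix q assume q: "q \<in> ?T"
        then have "q \<in> point_filter X ` pts X" unfolding point_filter_image basic_open_def by blast
        then obtain y where y: "y \<in> pts X" "q = point_filter X y" by blast
        then have "y \<in> V - W"
          using q point_filter_basic_open[OF VW(1)] point_filter_basic_open[OF VW(2)] by blast
        then show "q \<in> point_filter X ` G" using VW(4) y(2) by blast
      qed
      ultimately show ?thesis by blast
    qed
    then show "openin (topo ?Z) (point_filter X ` G)" by (subst openin_subopen) blast
  qed
qed

theorem point_filter_L_iso: "L_iso X (spec_obj (clop_obj X)) (point_filter X)"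
proof (rule L_iso_of_homeomorphism)
  show "Lspace X" by (rule Lspace_axioms)
  show "Lspace (spec_obj (clop_obj X))" by (rule clop_frame.spec.Lspace_axioms)
  show "homeomorphic_map (topo X) (topo (spec_obj (clop_obj X))) (point_filter X)"
    by (rule point_filter_homeomorphism)
  show "point_filter X \<in> extensional (pts X)" by (simp add: point_filter_def)
  show "(point_filter X x, point_filter X y) \<in> ord (spec_obj (clop_obj X)) \<longleftrightarrow> (x, y) \<in> ord X"
    if "x \<in> pts X" "y \<in> pts X" for x y
    using that by (simp add: ord_spec_obj point_filter_prime point_filter_subset_iff)
qed

end

section \<open>The two categories and the duality\<close>

lemma Obj_KRFrm: "L \<in> Obj KRFrm \<longleftrightarrow> frame L \<and> compact_frame L \<and> regular_frame L"
  by (simp add: KRFrm_def frame_iff_is_frame)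

lemma Obj_KRLPries: "X \<in> Obj KRLPries \<longleftrightarrow> Lspace X \<and> L_compact X \<and> L_regular X"
  by (simp add: KRLPries_def KRL_space_def Lspace_iff)

lemma Hom_KRFrm: "Hom KRFrm = frame_homs" and Hom_KRLPries: "Hom KRLPries = L_morphisms"
  by (simp_all add: KRFrm_def KRLPries_def)

lemma Comp_KRFrm: "Comp KRFrm L M N g f = compose (carrier L) g f"
  and Comp_KRLPries: "Comp KRLPries X Y Z g' f' = compose (pts X) g' f'"
  by (simp_all add: KRFrm_def KRLPries_def)

lemma Id_KRFrm: "Id KRFrm L = (\<lambda>x\<in>carrier L. x)" and Id_KRLPries: "Id KRLPries X = (\<lambda>x\<in>pts X. x)"
  by (simp_all add: KRFrm_def KRLPries_def)

lemmas KRFrm_simps = Hom_KRFrm Comp_KRFrm Id_KRFrm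
lemmas KRLPries_simps = Hom_KRLPries Comp_KRLPries Id_KRLPries

lemma frame_homI: "\<lbrakk>frame L; frame M; h \<in> frame_homs L M\<rbrakk> \<Longrightarrow> frame_hom L M h"
  by (simp add: frame_hom_def frame_hom_axioms_def)

lemma L_morphismI: "\<lbrakk>Lspace X; Lspace Y; f \<in> L_morphisms X Y\<rbrakk> \<Longrightarrow> L_morphism X Y f"
  by (simp add: L_morphism_def L_morphism_axioms_def)

lemma frame_homs_id:
  assumes "frame L"
  shows "(\<lambda>x\<in>carrier L. x) \<in> frame_homs L L"
proof -
  interpret frame L by fact
  have "(\<lambda>x\<in>carrier L. x) ` S = S" if "S \<subseteq> carrier L" for S
    using that by (auto simp: image_iff subset_iff)
  then show ?thesis unfolding frame_homs_def by simp
qed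

lemma frame_homs_compose:
  assumes "frame L" "frame M" "frame N" "f \<in> frame_homs L M" "g \<in> frame_homs M N"
  shows "compose (carrier L) g f \<in> frame_homs L N"
proof -
  interpret f: frame_hom L M f by (rule frame_homI) fact+
  interpret g: frame_hom M N g by (rule frame_homI) fact+
  have "compose (carrier L) g f (\<Squnion>\<^bsub>L\<^esub> S) = \<Squnion>\<^bsub>N\<^esub> (compose (carrier L) g f ` S)" if S: "S \<subseteq> carrier L" for S
  proof -
    have "compose (carrier L) g f ` S = g ` f ` S" using S by (auto simp: compose_def image_iff subset_iff)
    moreover have "f ` S \<subseteq> carrier M" using S by auto
    ultimately show ?thesis using S by (simp add: compose_def f.h_Sup g.h_Sup)
  qed
  then show ?thesis
    unfolding frame_homs_def
    by (simp add: compose_def f.h_top g.h_top f.h_meet g.h_meet)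
qed

lemma L_morphisms_id:
  assumes "Lspace X"
  shows "(\<lambda>x\<in>pts X. x) \<in> L_morphisms X X"
proof -
  interpret Lspace X by fact
  have "continuous_map (topo X) (topo X) (\<lambda>x\<in>pts X. x)"
    using continuous_map_id[of "topo X"] by (rule continuous_map_eq) simp
  moreover have "{x \<in> pts X. (\<lambda>x\<in>pts X. x) x \<in> topo X closure_of U} =
      topo X closure_of {x \<in> pts X. (\<lambda>x\<in>pts X. x) x \<in> U}" if "upset X U" for U
  proof -
    have "U \<subseteq> pts X" using that unfolding upset_def by (rule conjunct1)
    then have "{x \<in> pts X. (\<lambda>x\<in>pts X. x) x \<in> U} = U" by auto
    moreover have "{x \<in> pts X. (\<lambda>x\<in>pts X. x) x \<in> topo X closure_of U} = topo X closure_of U"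
      using closure_of_subset_topspace[of "topo X" U] by auto
    ultimately show ?thesis by simp
  qed
  ultimately show ?thesis unfolding L_morphisms_def using ord_subset by auto
qed

lemma L_morphisms_compose:
  assumes "Lspace X" "Lspace Y" "Lspace Z" "f \<in> L_morphisms X Y" "g \<in> L_morphisms Y Z"
  shows "compose (pts X) g f \<in> L_morphisms X Z"
proof -
  interpret f: L_morphism X Y f by (rule L_morphismI) fact+
  interpret g: L_morphism Y Z g by (rule L_morphismI) fact+
  have "continuous_map (topo X) (topo Z) (compose (pts X) g f)"
    using continuous_map_compose[OF f.props(3) g.props(3)] by (rule continuous_map_eq) (simp add: compose_def)
  moreover have "{x \<in> pts X. compose (pts X) g f x \<in> topo Z closure_of U} =
      topo X closure_of {x \<in> pts X. compose (pts X) g f x \<in> U}"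
    if U: "openin (topo Z) U" "upset Z U" for U
  proof -
    have "{x \<in> pts X. compose (pts X) g f x \<in> A} = {x \<in> pts X. f x \<in> {y \<in> pts Y. g y \<in> A}}" for A
      using f.props(2) by (auto simp: compose_def)
    then show ?thesis
      by (simp only: g.props(5)[OF U] f.props(5)[OF g.preimage_open[OF U(1)] g.preimage_upset[OF U(2)]])
  qed
  moreover have "(compose (pts X) g f x, compose (pts X) g f y) \<in> ord Z" if "(x, y) \<in> ord X" for x y
    using f.X.ord_subset[OF that] f.props(4)[OF that] g.props(4) by (simp add: compose_def)
  moreover have "compose (pts X) g f \<in> pts X \<rightarrow>\<^sub>E pts Z"
    using f.props(2) g.props(2) by (auto simp: compose_def)
  ultimately show ?thesis unfolding L_morphisms_def by blast
qed

text \<open>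
  With hom-sets of extensional functions, the category laws hold as equations between total
  functions.
\<close>

lemma PiE_compose_laws:
  assumes "f \<in> A \<rightarrow>\<^sub>E B"
  shows "compose A f (\<lambda>x\<in>A. x) = f" "compose A (\<lambda>y\<in>B. y) f = f"
    "compose A h (compose A g f) = compose A (compose B h g) f"
  using assms by (auto simp: PiE_def intro: compose_Id Id_compose compose_assoc)

theorem is_category_KRFrm: "is_category (KRFrm :: ('a gorder, 'a \<Rightarrow> 'a) category)"
proof -
  have ext: "f \<in> carrier L \<rightarrow>\<^sub>E carrier M" if "f \<in> frame_homs L M" for f and L M :: "'a gorder"
    using that unfolding frame_homs_def by blast
  show ?thesis
    unfolding is_category_def KRFrm_simps
    by (intro conjI ballI) (auto simp: Obj_KRFrm frame_homs_id frame_homs_compose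
      intro: PiE_compose_laws[OF ext])
qed

theorem is_category_KRLPries: "is_category (KRLPries :: ('b ordered_space, 'b \<Rightarrow> 'b) category)"
  unfolding is_category_def KRLPries_simps
  by (intro conjI ballI) (auto simp: Obj_KRLPries L_morphisms_id L_morphisms_compose
      intro: PiE_compose_laws[OF L_morphismsD(1)])

theorem spec_functor:
  "contravariant_functor
     (KRFrm :: ('a gorder, 'a \<Rightarrow> 'a) category)
     (KRLPries :: ('a set ordered_space, 'a set \<Rightarrow> 'a set) category) spec_obj spec_mor"
  unfolding contravariant_functor_def KRFrm_simps KRLPries_simps
proof (intro conjI ballI)
  fix L :: "'a gorder" assume L: "L \<in> Obj KRFrm"
  then interpret L: frame L by (simp add: Obj_KRFrm)
  show "spec_obj L \<in> Obj KRLPries"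
    using L L.KRL_space_spec by (simp add: Obj_KRFrm KRLPries_def)
  show "spec_mor L L (\<lambda>x\<in>carrier L. x) = (\<lambda>P\<in>pts (spec_obj L). P)"
  proof -
    have "{a \<in> carrier L. (\<lambda>x\<in>carrier L. x) a \<in> P} = P" if "P \<in> prime_filters L" for P
      using prime_filtersD(1)[OF that] by auto
    then show ?thesis unfolding spec_mor_def L.pts_spec_obj by (rule restrict_ext)
  qed
  fix M :: "'a gorder" assume M: "M \<in> Obj KRFrm"
  show "spec_mor L M f \<in> L_morphisms (spec_obj M) (spec_obj L)" if f: "f \<in> frame_homs L M" for f
  proof -
    interpret frame_hom L M f using L M f by (intro frame_homI) (simp_all add: Obj_KRFrm)
    show ?thesis by (rule spec_mor_L_morphism)
  qed
  fix N :: "'a gorder" and f g assume N: "N \<in> Obj KRFrm" and f: "f \<in> frame_homs L M" and g: "g \<in> frame_homs M N"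
  interpret f: frame_hom L M f using L M f by (intro frame_homI) (simp_all add: Obj_KRFrm)
  interpret g: frame_hom M N g using M N g by (intro frame_homI) (simp_all add: Obj_KRFrm)
  show "spec_mor L N (compose (carrier L) g f) =
      compose (pts (spec_obj N)) (spec_mor L M f) (spec_mor M N g)"
  proof
    fix P
    show "spec_mor L N (compose (carrier L) g f) P =
        compose (pts (spec_obj N)) (spec_mor L M f) (spec_mor M N g) P"
      using g.preimage_prime_filter[of P]
      by (auto simp: compose_def g.M.pts_spec_obj spec_mor_def)
  qed
qed

theorem clop_functor:
  "contravariant_functor
     (KRLPries :: ('b ordered_space, 'b \<Rightarrow> 'b) category)
     (KRFrm :: ('b set gorder, 'b set \<Rightarrow> 'b set) category) clop_obj clop_mor"
  unfolding contravariant_functor_def KRFrm_simps KRLPries_simps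
proof (intro conjI ballI)
  fix X :: "'b ordered_space" assume X: "X \<in> Obj KRLPries"
  then interpret X: Lspace X by (simp add: Obj_KRLPries)
  show "clop_obj X \<in> Obj KRFrm"
    using X X.frame_clop_obj by (simp add: Obj_KRFrm Obj_KRLPries X.compact_clop_obj_iff X.regular_clop_obj_iff)
  show "clop_mor X X (\<lambda>x\<in>pts X. x) = (\<lambda>U\<in>carrier (clop_obj X). U)"
  proof -
    have "{x \<in> pts X. (\<lambda>x\<in>pts X. x) x \<in> U} = U" if "U \<in> ClopUp X" for U
      using X.ClopUpD(5)[OF that] by auto
    then show ?thesis unfolding clop_mor_def clop_obj_simps by (rule restrict_ext)
  qed
  fix Y :: "'b ordered_space" assume Y: "Y \<in> Obj KRLPries"
  show "clop_mor X Y f \<in> frame_homs (clop_obj Y) (clop_obj X)" if f: "f \<in> L_morphisms X Y" for f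
  proof -
    interpret L_morphism X Y f using X Y f by (intro L_morphismI) (simp_all add: Obj_KRLPries)
    show ?thesis by (rule clop_mor_frame_hom)
  qed
  fix Z :: "'b ordered_space" and f g
  assume Z: "Z \<in> Obj KRLPries" and f: "f \<in> L_morphisms X Y" and g: "g \<in> L_morphisms Y Z"
  interpret f: L_morphism X Y f using X Y f by (intro L_morphismI) (simp_all add: Obj_KRLPries)
  interpret g: L_morphism Y Z g using Y Z g by (intro L_morphismI) (simp_all add: Obj_KRLPries)
  show "clop_mor X Z (compose (pts X) g f) =
      compose (carrier (clop_obj Z)) (clop_mor X Y f) (clop_mor Y Z g)"
  proof
    fix U
    show "clop_mor X Z (compose (pts X) g f) U =
        compose (carrier (clop_obj Z)) (clop_mor X Y f) (clop_mor Y Z g) U"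
      using g.preimage_ClopUp[of U] f.props(2) by (auto simp: compose_def clop_mor_def)
  qed
qed

text \<open>
  The isomorphism is \<open>\<phi>\<close>; its naturality is the formula for the preimage of
  \<open>\<phi> a\<close> under a morphism of spectra.
\<close>

theorem KRFrm_unit:
  "KRFrm_naturally_iso_id
     (\<lambda>L :: 'a gorder. clop_obj (spec_obj L))
     (\<lambda>L M f. clop_mor (spec_obj M) (spec_obj L) (spec_mor L M f))"
  unfolding KRFrm_naturally_iso_id_def KRFrm_simps
proof (intro exI[of _ "\<lambda>L. \<lambda>a\<in>carrier L. basic_open L a"] conjI ballI)
  fix L :: "'a gorder" assume L: "L \<in> Obj KRFrm"
  then interpret L: frame L by (simp add: Obj_KRFrm)
  show "frame_iso L (clop_obj (spec_obj L)) (\<lambda>a\<in>carrier L. basic_open L a)"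
    by (rule order_iso_frame_iso[OF L.complete_lattice_axioms L.spec.complete_lattice_clop_obj L.order_iso_\<phi>])
  fix M f assume M: "M \<in> Obj KRFrm" and f: "f \<in> frame_homs L M"
  interpret f: frame_hom L M f using L M f by (intro frame_homI) (simp_all add: Obj_KRFrm)
  show "compose (carrier L) (\<lambda>a\<in>carrier M. basic_open M a) f =
      compose (carrier L) (clop_mor (spec_obj M) (spec_obj L) (spec_mor L M f)) (\<lambda>a\<in>carrier L. basic_open L a)"
    unfolding compose_def
  proof (rule restrict_ext)
    fix a assume a: "a \<in> carrier L"
    show "(\<lambda>a\<in>carrier M. basic_open M a) (f a) =
        clop_mor (spec_obj M) (spec_obj L) (spec_mor L M f) ((\<lambda>a\<in>carrier L. basic_open L a) a)"
      using a f.spec_mor_basic_open[OF a] L.\<phi>_ClopUp[OF a]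
      by (simp add: clop_mor_def f.M.pts_spec_obj)
  qed
qed

text \<open>
  The isomorphism sends a point to the prime filter of its clopen neighbourhoods that are
  upsets, and naturality holds because \<open>f x \<in> U\<close> is the same as membership of
  \<open>x\<close> in the preimage of \<open>U\<close>.
\<close>

theorem KRLPries_unit:
  "KRLPries_naturally_iso_id
     (\<lambda>X :: 'b ordered_space. spec_obj (clop_obj X))
     (\<lambda>X Y f. spec_mor (clop_obj Y) (clop_obj X) (clop_mor X Y f))"
  unfolding KRLPries_naturally_iso_id_def KRLPries_simps
proof (intro exI[of _ point_filter] conjI ballI)
  fix X :: "'b ordered_space" assume X: "X \<in> Obj KRLPries"
  then interpret X: Lspace X by (simp add: Obj_KRLPries)
  show "L_iso X (spec_obj (clop_obj X)) (point_filter X)"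
    by (rule X.point_filter_L_iso)
  fix Y f assume Y: "Y \<in> Obj KRLPries" and f: "f \<in> L_morphisms X Y"
  interpret f: L_morphism X Y f using X Y f by (intro L_morphismI) (simp_all add: Obj_KRLPries)
  show "compose (pts X) (point_filter Y) f =
      compose (pts X) (spec_mor (clop_obj Y) (clop_obj X) (clop_mor X Y f)) (point_filter X)"
    unfolding compose_def
  proof (rule restrict_ext)
    fix x assume x: "x \<in> pts X"
    show "point_filter Y (f x) = spec_mor (clop_obj Y) (clop_obj X) (clop_mor X Y f) (point_filter X x)"
      using x f.props(2)[OF x] X.point_filter_prime[OF x] f.preimage_ClopUp
      by (auto simp: spec_mor_def clop_mor_def point_filter_def)
  qed
qed

theorem corollary7p8:
  shows "is_category (KRFrm :: ('a gorder, 'a \<Rightarrow> 'a) category) \<and>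
    is_category (KRLPries :: ('b ordered_space, 'b \<Rightarrow> 'b) category) \<and>
    contravariant_functor
      (KRFrm :: ('a gorder, 'a \<Rightarrow> 'a) category)
      (KRLPries :: ('a set ordered_space, 'a set \<Rightarrow> 'a set) category)
      spec_obj spec_mor \<and>
    contravariant_functor
      (KRLPries :: ('b ordered_space, 'b \<Rightarrow> 'b) category)
      (KRFrm :: ('b set gorder, 'b set \<Rightarrow> 'b set) category)
      clop_obj clop_mor \<and>
    KRFrm_naturally_iso_id
      (\<lambda>L :: 'a gorder. clop_obj (spec_obj L))
      (\<lambda>L M f. clop_mor (spec_obj M) (spec_obj L) (spec_mor L M f)) \<and>
    KRLPries_naturally_iso_id
      (\<lambda>X :: 'b ordered_space. spec_obj (clop_obj X))
      (\<lambda>X Y f. spec_mor (clop_obj Y) (clop_obj X) (clop_mor X Y f))"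
  by (intro conjI is_category_KRFrm is_category_KRLPries spec_functor clop_functor
      KRFrm_unit KRLPries_unit)

end
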